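(* Let $k$ be an algebraically closed field of characteristic $0$, let $s_1,s_2\in k$ with $27-18s_1s_2-s_1^2s_2^2+4s_1^3+4s_2^3\neq 0$, and let $K=k(X,Y)$ be the genus $2$ field given by $Y^2=X^6-s_1X^4+s_2X^2-1$. Put $u=s_1s_2$ and $v=s_1^3+s_2^3$, and let $E_1=k(X^2,Y)$ and $E_2=k(X^2,XY)$ be its paired degree $2$ elliptic subfields. Then $E_1$ and $E_2$ are isomorphic (i.e. have equal $j$-invariants) if and only if $$(v^2-4u^3)(v-9u+27)=0 .$$
   Context: An elliptic subfield of degree 2 of $K$ is an intermediate field $k\subset E\subset K$ of genus 1 with $[K:E]=2$. *)

theory Defs
  imports "HOL-Computational_Algebra.Computational_Algebra"
begin

text \<open>
  The constant field is a type \<open>'k\<close>. Function fields over it are subsets of an arbitrary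
  extension field \<open>'f\<close>, into which \<open>'k\<close> is embedded by \<open>\<iota>\<close>. (A separate type for
  each function field is impossible, since it would depend on the coefficients of its equation.)
\<close>

definition field_embedding :: "('k::field \<Rightarrow> 'f::field) \<Rightarrow> bool" where
  "field_embedding \<iota> \<longleftrightarrow> \<iota> 1 = 1 \<and>
     (\<forall>a b. \<iota> (a + b) = \<iota> a + \<iota> b) \<and> (\<forall>a b. \<iota> (a * b) = \<iota> a * \<iota> b)"

definition is_subfield :: "'f::field set \<Rightarrow> bool" where
  "is_subfield F \<longleftrightarrow> 0 \<in> F \<and> 1 \<in> F \<and>
     (\<forall>x\<in>F. \<forall>y\<in>F. x + y \<in> F \<and> x * y \<in> F) \<and> (\<forall>x\<in>F. - x \<in> F \<and> inverse x \<in> F)"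

definition adjoin :: "('k::field \<Rightarrow> 'f::field) \<Rightarrow> 'f set \<Rightarrow> 'f set" where
  "adjoin \<iota> S = \<Inter>{F. is_subfield F \<and> range \<iota> \<subseteq> F \<and> S \<subseteq> F}"

definition transcendental_over :: "('k::field \<Rightarrow> 'f::field) \<Rightarrow> 'f \<Rightarrow> bool" where
  "transcendental_over \<iota> x \<longleftrightarrow> (\<forall>p. p \<noteq> 0 \<longrightarrow> poly (map_poly \<iota> p) x \<noteq> 0)"

text \<open>Isomorphism of extensions of the constant field: constants are fixed.\<close>

definition isomorphic_over ::
  "('k::field \<Rightarrow> 'f::field) \<Rightarrow> 'f set \<Rightarrow> 'f set \<Rightarrow> bool" where
  "isomorphic_over \<iota> E F \<longleftrightarrow> (\<exists>\<phi>. bij_betw \<phi> E F \<and>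
     (\<forall>x\<in>E. \<forall>y\<in>E. \<phi> (x + y) = \<phi> x + \<phi> y \<and> \<phi> (x * y) = \<phi> x * \<phi> y) \<and>
     (\<forall>c. \<phi> (\<iota> c) = \<iota> c))"

text \<open>\<open>E\<close> is the function field of the elliptic curve \<open>y\<^sup>2 = x\<^sup>3 + a x + b\<close>.\<close>

definition weierstrass_model ::
  "('k::field \<Rightarrow> 'f::field) \<Rightarrow> 'f set \<Rightarrow> 'k \<Rightarrow> 'k \<Rightarrow> bool" where
  "weierstrass_model \<iota> E a b \<longleftrightarrow> 4 * a ^ 3 + 27 * b ^ 2 \<noteq> 0 \<and>
     (\<exists>x y. transcendental_over \<iota> x \<and> y ^ 2 = x ^ 3 + \<iota> a * x + \<iota> b \<and> E = adjoin \<iota> {x, y})"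

text \<open>
  Over an algebraically closed field of characteristic 0 every field of genus 1 has a
  Weierstrass model, and the value below does not depend on the model.
\<close>

definition j_invariant :: "('k::field \<Rightarrow> 'f::field) \<Rightarrow> 'f set \<Rightarrow> 'k" where
  "j_invariant \<iota> E = (THE j. \<exists>a b. weierstrass_model \<iota> E a b \<and>
     j = 1728 * (4 * a ^ 3) / (4 * a ^ 3 + 27 * b ^ 2))"

end

(*
  If y^2 = f(x) and y'^2 = g(x') are Weierstrass models of the same field E, then each of x and x'
  has degree at most 2 over the field generated by the other.  Suppose first that both degrees are
  2.  By Gauss' lemma the minimal relation F(x, x') = 0 has bidegree (2,2).  Its discriminant with
  respect to x' is a quartic in x whose square root generates E over k(x); as f is a squarefree
  cubic, this quartic is c f with c constant, and likewise the other discriminant is d g.  The two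
  discriminants of a form of bidegree (2,2) have the same invariants I and J, and these determine
  a^3 : b^2, hence j.  If instead k(x) = k(x'), then x' is a Moebius transform of x and I, J
  are compared directly.  This replaces the usual argument with places and translations.

  With t = X^2 the field E1 is given by Y^2 = t^3 - s1 t^2 + s2 t - 1, and (1/t, i X Y / t^2)
  satisfies the same equation with s1 and s2 exchanged.  The discriminants agree, so the
  j-invariants agree iff (s1^2 - 3 s2)^3 = (s2^2 - 3 s1)^3, and the difference of the two sides is
  (s1^3 - s2^3) (v - 9 u + 27), where (s1^3 - s2^3)^2 = v^2 - 4 u^3.
*)

theory Submission
  imports Defs
begin

section \<open>Ring homomorphisms and polynomials\<close>

text \<open>Shared by constant embeddings, coefficient specialization and evaluation at a point, so
  that polynomial identities are carried along all of them by the same simp rules.\<close>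

locale unital_ring_hom =
  fixes h :: "'a::comm_ring_1 \<Rightarrow> 'b::comm_ring_1"
  assumes one [simp]: "h 1 = 1"
    and add [simp]: "h (x + y) = h x + h y"
    and mult [simp]: "h (x * y) = h x * h y"
begin

lemma zero [simp]: "h 0 = 0"
  using add[of 0 0] by simp

lemma uminus [simp]: "h (- x) = - h x"
  using add[of x "- x"] by (simp add: eq_neg_iff_add_eq_0 add.commute)

lemma diff [simp]: "h (x - y) = h x - h y"
  using add[of x "- y"] by simp

lemma power [simp]: "h (x ^ n) = h x ^ n"
  by (induction n) simp_all

lemma of_nat: "h (of_nat n) = of_nat n"
  by (induction n) simp_all

lemma numeral [simp]: "h (numeral n) = numeral n"
  using of_nat[of "numeral n"] by simp

lemma sum: "h (sum g A) = (\<Sum>x\<in>A. h (g x))"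
  by (induction A rule: infinite_finite_induct) simp_all

lemma map_poly_hom: "unital_ring_hom (map_poly h)"
proof
  show "map_poly h 1 = 1" by simp
  show "map_poly h (p + q) = map_poly h p + map_poly h q" for p q
    by (intro poly_eqI) (simp add: coeff_map_poly)
  show "map_poly h (p * q) = map_poly h p * map_poly h q" for p q
    by (intro poly_eqI) (simp add: coeff_map_poly coeff_mult sum)
qed

lemma eval_hom: "unital_ring_hom (\<lambda>p. poly (map_poly h p) x)"
proof -
  interpret m: unital_ring_hom "map_poly h" by (rule map_poly_hom)
  show ?thesis by standard simp_all
qed

lemma map_poly_smult: "map_poly h (smult c p) = smult (h c) (map_poly h p)"
  by (intro poly_eqI) (simp add: coeff_map_poly)

lemma map_poly_pCons_hom: "map_poly h (pCons c p) = pCons (h c) (map_poly h p)"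
  by (simp add: map_poly_pCons)

end

lemma poly_hom: "unital_ring_hom (\<lambda>p. poly p s)"
  by standard simp_all

section \<open>Primitive polynomials over k[S] and Gauss' lemma\<close>

abbreviation specialize :: "'k::comm_ring_1 \<Rightarrow> 'k poly poly \<Rightarrow> 'k poly" where
  "specialize s \<equiv> map_poly (\<lambda>p. poly p s)"

lemma specialize_eq_0_iff:
  fixes G :: "'k::field poly poly"
  shows "specialize s G = 0 \<longleftrightarrow> [:[:-s, 1:]:] dvd G"
proof -
  have "specialize s G = 0 \<longleftrightarrow> (\<forall>i. poly (coeff G i) s = 0)"
    by (simp add: poly_eq_iff coeff_map_poly)
  also have "\<dots> \<longleftrightarrow> [:[:-s, 1:]:] dvd G"
    by (simp add: const_poly_dvd_iff poly_eq_0_iff_dvd)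
  finally show ?thesis .
qed

text \<open>This is trivial content: over an algebraically closed field a nonconstant common divisor
  of the coefficients has a root \<open>s\<close>, and specializing at \<open>s\<close> gives
  0.\<close>

definition primitive_poly :: "'k::comm_ring_1 poly poly \<Rightarrow> bool" where
  "primitive_poly G \<longleftrightarrow> (\<forall>s. specialize s G \<noteq> 0)"

text \<open>Each vanishing specialization splits off a factor S - s, which lowers the degree of the
  leading coefficient, so the process stops.\<close>

lemma primitive_part_exists:
  fixes G :: "'k::alg_closed_field poly poly"
  assumes "G \<noteq> 0"
  obtains D G' where "D \<noteq> 0" "G = smult D G'" "primitive_poly G'"
proof -
  have "\<exists>D G'. D \<noteq> 0 \<and> G = smult D G' \<and> primitive_poly G'" using assms
  proof (induction "degree (lead_coeff G)" arbitrary: G rule: less_induct)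
    case less
    show ?case
    proof (cases "primitive_poly G")
      case True
      then show ?thesis by (intro exI[of _ 1] exI[of _ G]) simp
    next
      case False
      then obtain s where "specialize s G = 0" by (auto simp: primitive_poly_def)
      then obtain G1 where G1: "G = smult [:-s, 1:] G1"
        by (auto simp: specialize_eq_0_iff elim: dvdE)
      have G1_0: "G1 \<noteq> 0" using less.prems G1 by auto
      have "degree (lead_coeff G1) < degree (lead_coeff G)"
        using G1_0 unfolding G1 by (simp add: lead_coeff_smult degree_mult_eq del: mult_pCons_left)
      from less.hyps[OF this G1_0] obtain D G'
        where "D \<noteq> 0" "G1 = smult D G'" "primitive_poly G'" by blast
      then show ?thesis
        using G1 by (intro exI[of _ "[:-s, 1:] * D"] exI[of _ G']) (simp del: mult_pCons_left)
    qed
  qed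
  then show ?thesis using that by blast
qed

text \<open>The roots of \<open>c\<close> are removed one at a time: at a root \<open>s\<close> the
  product \<open>G * Q\<close> specializes to 0 in the domain k[T] while \<open>G\<close> does not,
  so S - s divides \<open>Q\<close> and cancels.\<close>

lemma gauss_cancel:
  fixes G H Q :: "'k::alg_closed_field poly poly"
  assumes "primitive_poly G" "c \<noteq> 0" "smult c H = G * Q"
  shows "G dvd H"
  using assms(2,3)
proof (induction "degree c" arbitrary: c Q rule: less_induct)
  case less
  show ?case
  proof (cases "degree c = 0")
    case True
    then obtain a where a: "c = [:a:]" by (rule degree_eq_zeroE)
    with less.prems(1) have "smult [:inverse a:] (smult c H) = H" by (simp flip: one_pCons)
    then have "H = G * smult [:inverse a:] Q"
      by (simp only: less.prems(2) mult_smult_right)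
    then show ?thesis by (rule dvdI)
  next
    case False
    then obtain s where s: "poly c s = 0"
      using alg_closed_imp_poly_has_root by blast
    interpret p: unital_ring_hom "\<lambda>p. poly p s" by (rule poly_hom)
    interpret sp: unital_ring_hom "specialize s" by (rule p.map_poly_hom)
    have "specialize s G * specialize s Q = 0"
      using arg_cong[OF less.prems(2), of "specialize s"] s by (simp add: p.map_poly_smult)
    then have "specialize s Q = 0" using assms(1) by (auto simp: primitive_poly_def)
    then obtain Q1 where Q1: "Q = smult [:-s, 1:] Q1"
      by (auto simp: specialize_eq_0_iff elim: dvdE)
    from s obtain c1 where c1: "c = [:-s, 1:] * c1" by (auto simp: poly_eq_0_iff_dvd)
    have "smult [:-s, 1:] (smult c1 H) = smult [:-s, 1:] (G * Q1)"
      using less.prems(2) by (simp add: Q1 c1 del: mult_pCons_left)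
    then have "smult [:-s, 1:] (smult c1 H - G * Q1) = 0"
      by (simp add: smult_diff_right)
    then have "smult c1 H = G * Q1" by simp
    moreover have "c1 \<noteq> 0" using less.prems c1 by auto
    moreover have "degree c1 < degree c"
      using \<open>c1 \<noteq> 0\<close> unfolding c1 by (simp add: degree_mult_eq del: mult_pCons_left)
    ultimately show ?thesis using less.hyps by blast
  qed
qed

text \<open>The remainder of the pseudo-division of \<open>H\<close> by \<open>G\<close> is a
  smaller relation, hence 0. So \<open>G\<close> divides \<open>H\<close> times a power of the
  leading coefficient of \<open>G\<close>, and \<open>gauss_cancel\<close> removes that
  power.\<close>

lemma minimal_relation_dvd:
  fixes e :: "'k::alg_closed_field poly \<Rightarrow> 'f::field" and G H :: "'k poly poly"
  assumes "unital_ring_hom e"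
    and minimal: "\<And>R. poly (map_poly e R) z = 0 \<Longrightarrow> degree R < degree G \<Longrightarrow> R = 0"
    and "primitive_poly G" "degree G > 0"
    and "poly (map_poly e G) z = 0" "poly (map_poly e H) z = 0"
  shows "G dvd H"
proof -
  interpret unital_ring_hom e by fact
  interpret ev: unital_ring_hom "\<lambda>p. poly (map_poly e p) z" by (rule eval_hom)
  have G0: "G \<noteq> 0" using assms(4) by auto
  obtain Q R where QR: "pseudo_divmod H G = (Q, R)" by fastforce
  note 1 = pseudo_divmod[OF G0 QR]
  let ?c = "lead_coeff G ^ (Suc (degree H) - degree G)"
  have "poly (map_poly e R) z = 0"
    using arg_cong[OF 1(1), of "\<lambda>p. poly (map_poly e p) z"] assms(5,6)
    by (simp add: map_poly_smult)
  with 1(2) minimal assms(4) have "R = 0" by auto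
  with 1(1) have "smult ?c H = G * Q" by simp
  moreover have "?c \<noteq> 0" using G0 by simp
  ultimately show ?thesis using gauss_cancel[OF assms(3)] by blast
qed

section \<open>Degrees in the coefficient variable S\<close>

lemma coeff_mult_at_bounds:
  fixes p q :: "'a::comm_semiring_0 poly"
  assumes "degree p \<le> m" "degree q \<le> n"
  shows "coeff (p * q) (m + n) = coeff p m * coeff q n"
proof -
  have "coeff p i * coeff q (m + n - i) = (if i = m then coeff p m * coeff q n else 0)"
    if "i \<le> m + n" for i
  proof (cases i m rule: linorder_cases)
    case less
    then have "coeff q (m + n - i) = 0" using assms by (intro coeff_eq_0) simp
    with less show ?thesis by simp
  next
    case greater
    then have "coeff p i = 0" using assms by (intro coeff_eq_0) simp
    with greater show ?thesis by simp
  qed simp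
  then show ?thesis by (simp add: coeff_mult)
qed

text \<open>\<open>m\<close> is the degree in S, and the nonzero polynomial in T is the leading
  coefficient with respect to S.\<close>

lemma max_coeff_degree_exists:
  fixes P :: "'k::comm_ring_1 poly poly"
  assumes "P \<noteq> 0"
  obtains m where "\<And>i. degree (coeff P i) \<le> m" "map_poly (\<lambda>c. coeff c m) P \<noteq> 0"
proof -
  let ?D = "(\<lambda>i. degree (coeff P i)) ` {..degree P}"
  define m where "m = Max ?D"
  have le: "degree (coeff P i) \<le> m" for i
    unfolding m_def by (cases "i \<le> degree P") (auto simp: coeff_eq_0)
  have "map_poly (\<lambda>c. coeff c m) P \<noteq> 0"
  proof (cases "m = 0")
    \<comment> \<open>A coefficient of maximal degree 0 may be the zero polynomial, so the leading
      coefficient in T serves as witness here.\<close>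
    case True
    with le have "degree (lead_coeff P) = 0" by simp
    then have "coeff (lead_coeff P) 0 \<noteq> 0" using assms
      by (metis leading_coeff_0_iff)
    then have "coeff (map_poly (\<lambda>c. coeff c m) P) (degree P) \<noteq> 0"
      using True by (simp add: coeff_map_poly)
    then show ?thesis by force
  next
    case False
    have "m \<in> ?D" unfolding m_def by (intro Max_in) auto
    then obtain i where i: "m = degree (coeff P i)" by auto
    with False have "coeff (coeff P i) m \<noteq> 0" by auto
    then have "coeff (map_poly (\<lambda>c. coeff c m) P) i \<noteq> 0" by (simp add: coeff_map_poly)
    then show ?thesis by force
  qed
  with le that show ?thesis by blast
qed

text \<open>Elements of \<open>'k poly poly\<close> are polynomials in \<open>T\<close> over \<open>k[S]\<close>; a bound on the degrees of
  the coefficients is a bound on the degree in \<open>S\<close>.\<close>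

lemma coeff_degree_le_of_dvd:
  fixes G H :: "'k::idom poly poly"
  assumes "G dvd H" "H \<noteq> 0" "\<And>i. degree (coeff H i) \<le> n"
  shows "degree (coeff G i) \<le> n"
proof -
  from assms(1) obtain Q where H: "H = G * Q" by (auto elim: dvdE)
  with assms(2) have 0: "G \<noteq> 0" "Q \<noteq> 0" by auto
  obtain m where m: "\<And>i. degree (coeff G i) \<le> m" "map_poly (\<lambda>c. coeff c m) G \<noteq> 0"
    using max_coeff_degree_exists[OF 0(1)] by blast
  obtain l where l: "\<And>i. degree (coeff Q i) \<le> l" "map_poly (\<lambda>c. coeff c l) Q \<noteq> 0"
    using max_coeff_degree_exists[OF 0(2)] by blast
  \<comment> \<open>Leading coefficients in S multiply over a domain, so degrees in S add and that
    of \<open>G\<close> cannot exceed that of \<open>H\<close>.\<close>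
  have "map_poly (\<lambda>c. coeff c (m + l)) H
      = map_poly (\<lambda>c. coeff c m) G * map_poly (\<lambda>c. coeff c l) Q"
    unfolding H
    by (intro poly_eqI)
      (simp add: coeff_map_poly coeff_mult[of G] coeff_mult[of "map_poly _ _"] coeff_sum
        coeff_mult_at_bounds m(1) l(1))
  also have "\<dots> \<noteq> 0" using m(2) l(2) by simp
  finally obtain j where "coeff (coeff H j) (m + l) \<noteq> 0"
    by (auto simp: poly_eq_iff coeff_map_poly)
  then have "m + l \<le> n" using assms(3)[of j] le_degree le_trans by blast
  with m(1)[of i] show ?thesis by simp
qed

section \<open>Invariants of binary quartics\<close>

text \<open>The classical invariants of a binary quartic, of degrees 2 and 3 and weights 4 and 6.
  Coefficients are read up to index 4 whatever the degree, so a cubic counts as a quartic with a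
  root at infinity.\<close>

definition quartic_I :: "'k::comm_ring_1 poly \<Rightarrow> 'k" where
  "quartic_I q = 12 * coeff q 4 * coeff q 0 - 3 * coeff q 3 * coeff q 1 + coeff q 2 ^ 2"

definition quartic_J :: "'k::comm_ring_1 poly \<Rightarrow> 'k" where
  "quartic_J q = 72 * coeff q 4 * coeff q 2 * coeff q 0 + 9 * coeff q 3 * coeff q 2 * coeff q 1
     - 27 * coeff q 4 * coeff q 1 ^ 2 - 27 * coeff q 0 * coeff q 3 ^ 2 - 2 * coeff q 2 ^ 3"

lemma coeff_quartic:
  "coeff [:a, b, c, d, e:] 0 = a" "coeff [:a, b, c, d, e:] 1 = b" "coeff [:a, b, c, d, e:] 2 = c"
  "coeff [:a, b, c, d, e:] 3 = d" "coeff [:a, b, c, d, e:] 4 = e"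
  by (simp_all add: numeral_eq_Suc)

text \<open>\<open>P\<close> and \<open>Q\<close> are the two discriminants of the form of bidegree (2,2) with coefficient
  matrix \<open>(A, B, C)\<close>.\<close>

lemma quartic_invariants_discriminants:
  fixes A0 A1 A2 B0 B1 B2 C0 C1 C2 :: "'k::idom"
  defines "P \<equiv> [:B0, B1, B2:]\<^sup>2 - 4 * [:A0, A1, A2:] * [:C0, C1, C2:]"
    and "Q \<equiv> [:C1, B1, A1:]\<^sup>2 - 4 * [:C2, B2, A2:] * [:C0, B0, A0:]"
  shows "quartic_I P = quartic_I Q" "quartic_J P = quartic_J Q"
proof -
  have P: "P = [:B0\<^sup>2 - 4*A0*C0, 2*B0*B1 - 4*(A0*C1 + A1*C0),
      B1\<^sup>2 + 2*B0*B2 - 4*(A0*C2 + A1*C1 + A2*C0), 2*B1*B2 - 4*(A1*C2 + A2*C1), B2\<^sup>2 - 4*A2*C2:]"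
    unfolding P_def by (simp add: power2_eq_square numeral_poly algebra_simps)
  have Q: "Q = [:C1\<^sup>2 - 4*C2*C0, 2*C1*B1 - 4*(C2*B0 + B2*C0),
      B1\<^sup>2 + 2*C1*A1 - 4*(C2*A0 + B2*B0 + A2*C0), 2*B1*A1 - 4*(B2*A0 + A2*B0), A1\<^sup>2 - 4*A2*A0:]"
    unfolding Q_def by (simp add: power2_eq_square numeral_poly algebra_simps)
  show "quartic_I P = quartic_I Q"
    unfolding quartic_I_def P Q by (simp only: coeff_quartic) algebra
  show "quartic_J P = quartic_J Q"
    unfolding quartic_J_def P Q by (simp only: coeff_quartic) algebra
qed

definition weierstrass_cubic :: "'k::comm_ring_1 \<Rightarrow> 'k \<Rightarrow> 'k poly" where
  "weierstrass_cubic a b = [:b, a, 0, 1:]"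

lemma quartic_invariants_weierstrass:
  "quartic_I (smult c (weierstrass_cubic a b)) = - 3 * (c\<^sup>2 * a)"
  "quartic_J (smult c (weierstrass_cubic a b)) = - 27 * (c ^ 3 * b)"
  by (simp_all add: quartic_I_def quartic_J_def weierstrass_cubic_def numeral_eq_Suc algebra_simps)

text \<open>\<open>q\<close> is \<open>r ^ 4\<close> times the Weierstrass cubic at
  \<open>p / r\<close>, that is, the quartic form after a linear substitution. Weights 4 and 6 bring
  in these powers of the determinant, whose square is \<open>d\<close>.\<close>

lemma quartic_invariants_moebius:
  fixes p0 p1 r0 r1 a b :: "'k::idom"
  defines "p \<equiv> [:p0, p1:]" and "r \<equiv> [:r0, r1:]" and "d \<equiv> (p1 * r0 - p0 * r1)\<^sup>2"
  defines "q \<equiv> r * (p ^ 3 + smult a (p * r\<^sup>2) + smult b (r ^ 3))"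
  shows "quartic_I q = - 3 * (d\<^sup>2 * a)" "quartic_J q = - 27 * (d ^ 3 * b)"
proof -
  have q: "q = [:r0*(p0^3 + a*p0*r0\<^sup>2 + b*r0^3),
     r1*(p0^3 + a*p0*r0\<^sup>2 + b*r0^3) + r0*(3*p0\<^sup>2*p1 + a*(p1*r0\<^sup>2 + 2*p0*r0*r1) + 3*b*r0\<^sup>2*r1),
     r1*(3*p0\<^sup>2*p1 + a*(p1*r0\<^sup>2 + 2*p0*r0*r1) + 3*b*r0\<^sup>2*r1)
       + r0*(3*p0*p1\<^sup>2 + a*(p0*r1\<^sup>2 + 2*p1*r0*r1) + 3*b*r0*r1\<^sup>2),
     r1*(3*p0*p1\<^sup>2 + a*(p0*r1\<^sup>2 + 2*p1*r0*r1) + 3*b*r0*r1\<^sup>2) + r0*(p1^3 + a*p1*r1\<^sup>2 + b*r1^3),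
     r1*(p1^3 + a*p1*r1\<^sup>2 + b*r1^3):]"
    unfolding q_def p_def r_def
    by (simp add: power2_eq_square power3_eq_cube algebra_simps)
  show "quartic_I q = - 3 * (d\<^sup>2 * a)"
    unfolding quartic_I_def q d_def by (simp only: coeff_quartic) algebra
  show "quartic_J q = - 27 * (d ^ 3 * b)"
    unfolding quartic_J_def q d_def by (simp only: coeff_quartic) algebra
qed

text \<open>Passing from (a, b) to (c^2 a, c^3 b) multiplies both a^3 and b^2 by c^6.\<close>

lemma weighted_ratio_eq:
  fixes a b a' b' c d :: "'k::idom"
  assumes "c \<noteq> 0" "d \<noteq> 0" "c\<^sup>2 * a = d\<^sup>2 * a'" "c ^ 3 * b = d ^ 3 * b'"
  shows "a ^ 3 * b'\<^sup>2 = a' ^ 3 * b\<^sup>2"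
proof -
  have "(c * d) ^ 6 * (a ^ 3 * b'\<^sup>2) = (c\<^sup>2 * a) ^ 3 * (d ^ 3 * b')\<^sup>2" by algebra
  also have "\<dots> = (d\<^sup>2 * a') ^ 3 * (c ^ 3 * b)\<^sup>2" using assms by simp
  also have "\<dots> = (c * d) ^ 6 * (a' ^ 3 * b\<^sup>2)" by algebra
  finally show ?thesis using assms(1,2) by simp
qed

section \<open>Subfields generated by a point of a Weierstrass curve\<close>

lemma field_embedding_hom: "field_embedding \<iota> \<Longrightarrow> unital_ring_hom \<iota>"
  by (simp add: field_embedding_def unital_ring_hom_def)

lemma adjoin_subfield:
  shows "is_subfield (adjoin \<iota> S)" "range \<iota> \<subseteq> adjoin \<iota> S" "S \<subseteq> adjoin \<iota> S"
  by (auto simp: adjoin_def is_subfield_def)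

lemma adjoin_least:
  assumes "is_subfield F" "range \<iota> \<subseteq> F" "S \<subseteq> F"
  shows "adjoin \<iota> S \<subseteq> F"
  using assms by (auto simp: adjoin_def)

locale subfield =
  fixes F :: "'f::field set"
  assumes is_subfield: "is_subfield F"
begin

lemma zero_mem: "0 \<in> F"
  and one_mem: "1 \<in> F"
  and add_mem: "x \<in> F \<Longrightarrow> y \<in> F \<Longrightarrow> x + y \<in> F"
  and mult_mem: "x \<in> F \<Longrightarrow> y \<in> F \<Longrightarrow> x * y \<in> F"
  and uminus_mem: "x \<in> F \<Longrightarrow> - x \<in> F"
  and inverse_mem: "x \<in> F \<Longrightarrow> inverse x \<in> F"
  using is_subfield by (auto simp: is_subfield_def)

lemma diff_mem: "x \<in> F \<Longrightarrow> y \<in> F \<Longrightarrow> x - y \<in> F"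
  using add_mem[OF _ uminus_mem, of x y] by simp

lemma divide_mem: "x \<in> F \<Longrightarrow> y \<in> F \<Longrightarrow> x / y \<in> F"
  by (simp add: divide_inverse mult_mem inverse_mem)

lemma power_mem: "x \<in> F \<Longrightarrow> x ^ n \<in> F"
  by (induction n) (auto intro: one_mem mult_mem)

lemma poly_mem: "(\<And>i. coeff p i \<in> F) \<Longrightarrow> x \<in> F \<Longrightarrow> poly p x \<in> F"
proof (induction p)
  case (pCons a p)
  have "a \<in> F" using pCons.prems(1)[of 0] by simp
  moreover have "coeff p i \<in> F" for i using pCons.prems(1)[of "Suc i"] by simp
  ultimately show ?case using pCons by (auto intro: add_mem mult_mem)
qed (simp add: zero_mem)

lemmas mems = zero_mem one_mem add_mem mult_mem uminus_mem inverse_mem diff_mem divide_mem power_mem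

end

locale weierstrass_curve =
  fixes \<iota> :: "'k::{alg_closed_field, field_char_0} \<Rightarrow> 'f::field"
    and x y :: 'f and a b :: 'k
  assumes emb: "field_embedding \<iota>"
    and transc: "transcendental_over \<iota> x"
    and curve_eq: "y\<^sup>2 = x ^ 3 + \<iota> a * x + \<iota> b"
    and nonsing: "4 * a ^ 3 + 27 * b\<^sup>2 \<noteq> 0"
begin

sublocale emb: unital_ring_hom \<iota>
  by (rule field_embedding_hom[OF emb])

definition ev :: "'k poly \<Rightarrow> 'f" where
  "ev p = poly (map_poly \<iota> p) x"

sublocale ev: unital_ring_hom ev
  unfolding ev_def by (rule emb.eval_hom)

lemma ev_eq_0_iff [simp]: "ev p = 0 \<longleftrightarrow> p = 0"
  using transc by (auto simp: ev_def transcendental_over_def)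

lemma ev_eq_iff [simp]: "ev p = ev q \<longleftrightarrow> p = q"
  using ev_eq_0_iff[of "p - q"] by (simp del: ev_eq_0_iff)

lemma ev_pCons: "ev (pCons c p) = \<iota> c + x * ev p"
  by (simp add: ev_def emb.map_poly_pCons_hom)

abbreviation f :: "'k poly" where
  "f \<equiv> weierstrass_cubic a b"

lemma y_sq: "y\<^sup>2 = ev f"
  by (simp add: curve_eq weierstrass_cubic_def ev_pCons algebra_simps power3_eq_cube)

lemma f_props: "degree f = 3" "lead_coeff f = 1" "f \<noteq> 0"
  by (simp_all add: weierstrass_cubic_def)

text \<open>A double root \<open>s\<close> is a common root of \<open>f\<close> and its derivative;
  eliminating \<open>s\<close> from the two equations contradicts \<open>nonsing\<close>.\<close>

lemma f_simple_root:
  assumes "[:-s, 1:]\<^sup>2 dvd f"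
  shows False
proof -
  define l where "l = [:-s, 1:]"
  have l: "poly l s = 0" by (simp add: l_def)
  obtain q where q: "f = l * (l * q)"
    using assms unfolding l_def[symmetric] power2_eq_square by (metis dvdE mult.assoc)
  have "poly f s = 0" using l q by simp
  moreover have "poly (pderiv f) s = 0"
    unfolding q by (simp add: pderiv_mult l)
  ultimately have "b + s * (a + s * s * 1) = 0" "a + 3 * s * s = 0"
    by (simp_all add: weierstrass_cubic_def pderiv_pCons algebra_simps)
  then have "4 * a ^ 3 + 27 * b\<^sup>2 = 0" by algebra
  with nonsing show False by contradiction
qed

text \<open>As \<open>f\<close> is squarefree, every linear factor of \<open>R\<close> divides
  \<open>Q\<close>: otherwise its square would divide \<open>f\<close>. Cancelling these factors one
  by one leaves \<open>R\<close> constant.\<close>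

lemma square_times_f:
  assumes "R \<noteq> 0" "Q \<noteq> 0" "R\<^sup>2 * D = Q\<^sup>2 * f"
  shows "\<exists>S. S \<noteq> 0 \<and> D = S\<^sup>2 * f"
  using assms
proof (induction "degree R" arbitrary: R Q rule: less_induct)
  case less
  show ?case
  proof (cases "degree R = 0")
    case True
    then obtain r where r: "R = [:r:]" by (rule degree_eq_zeroE)
    with less.prems have "r \<noteq> 0" by auto
    have "[:inverse r:] * R = 1" using \<open>r \<noteq> 0\<close> by (simp add: r flip: one_pCons)
    then have "D = ([:inverse r:] * R)\<^sup>2 * D" by simp
    also have "\<dots> = [:inverse r:]\<^sup>2 * (R\<^sup>2 * D)" by (simp only: power_mult_distrib mult.assoc)
    also have "\<dots> = ([:inverse r:] * Q)\<^sup>2 * f"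
      unfolding less.prems(3) by (simp only: power_mult_distrib mult.assoc)
    finally show ?thesis using \<open>r \<noteq> 0\<close> less.prems(2)
      by (intro exI[of _ "[:inverse r:] * Q"]) simp
  next
    case False
    then obtain s where s: "poly R s = 0" using alg_closed_imp_poly_has_root by blast
    define l where "l = [:-s, 1:]"
    have l: "prime_elem l" "l \<noteq> 0" by (auto simp: l_def intro!: prime_elem_linear_field_poly)
    from s obtain R1 where R1: "R = l * R1" by (auto simp: poly_eq_0_iff_dvd l_def)
    have "l dvd Q"
    proof (rule ccontr)
      assume n: "\<not> l dvd Q"
      have "l * (l * (R1\<^sup>2 * D)) = Q\<^sup>2 * f"
        using less.prems(3) by (simp add: R1 power2_eq_square algebra_simps)
      then have "l dvd Q\<^sup>2 * f" by (metis dvd_triv_left)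
      with n l have "l dvd f" by (auto simp: prime_elem_dvd_mult_iff dest: prime_elem_dvd_power)
      then obtain f1 where f1: "f = l * f1" by (auto elim: dvdE)
      with \<open>l * (l * (R1\<^sup>2 * D)) = Q\<^sup>2 * f\<close> l have "l * (R1\<^sup>2 * D) = Q\<^sup>2 * f1" by simp
      then have "l dvd Q\<^sup>2 * f1" by (metis dvd_triv_left)
      with n l have "l dvd f1" by (auto simp: prime_elem_dvd_mult_iff dest: prime_elem_dvd_power)
      then have "l\<^sup>2 dvd f" by (auto simp: f1 power2_eq_square)
      then show False using f_simple_root by (simp add: l_def)
    qed
    then obtain Q1 where Q1: "Q = l * Q1" by (auto elim: dvdE)
    have "l\<^sup>2 * (R1\<^sup>2 * D) = l\<^sup>2 * (Q1\<^sup>2 * f)"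
      using less.prems(3) by (simp add: R1 Q1 power_mult_distrib mult.assoc)
    then have "R1\<^sup>2 * D = Q1\<^sup>2 * f" using l by simp
    moreover have "R1 \<noteq> 0" "Q1 \<noteq> 0" using less.prems R1 Q1 by auto
    moreover have "degree R1 < degree R"
      using \<open>R1 \<noteq> 0\<close> l unfolding R1 by (simp add: degree_mult_eq) (simp add: l_def)
    ultimately show ?thesis using less.hyps by blast
  qed
qed

text \<open>The degree of \<open>D\<close> is 2 deg S + 3, so the bound 4, which is that of a
  discriminant in bidegree (2,2), forces \<open>S\<close> to be constant.\<close>

lemma square_times_f_quartic:
  assumes "R \<noteq> 0" "Q \<noteq> 0" "R\<^sup>2 * D = Q\<^sup>2 * f" "degree D \<le> 4"
  obtains c where "c \<noteq> 0" "D = smult c f"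
proof -
  obtain S where S: "S \<noteq> 0" "D = S\<^sup>2 * f" using square_times_f[OF assms(1-3)] by blast
  then have "degree D = 2 * degree S + 3"
    by (simp add: degree_mult_eq degree_power_eq f_props)
  with assms(4) have "degree S = 0" by simp
  then obtain s where s: "S = [:s:]" by (rule degree_eq_zeroE)
  show ?thesis by (rule that[of "s\<^sup>2"]) (use S s in \<open>auto simp: power2_eq_square\<close>)
qed

text \<open>A dependence of 1 and \<open>y\<close> over k(x) gives P^2 = Q^2 f, where the left side
  has even degree and the right side odd degree.\<close>

lemma independent:
  assumes "ev P + ev Q * y = 0"
  shows "P = 0 \<and> Q = 0"
proof (rule ccontr)
  assume "\<not> (P = 0 \<and> Q = 0)"
  with assms have Q: "Q \<noteq> 0" by auto
  have "ev P = - (ev Q * y)" using assms by (simp add: eq_neg_iff_add_eq_0)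
  then have "ev (P\<^sup>2) = ev (Q\<^sup>2 * f)" by (simp add: power_mult_distrib y_sq)
  then have eq: "P\<^sup>2 = Q\<^sup>2 * f" by (simp only: ev_eq_iff)
  then have "P \<noteq> 0" using Q f_props by auto
  then have "2 * degree P = 2 * degree Q + 3"
    using arg_cong[OF eq, of degree] Q f_props by (simp add: degree_mult_eq degree_power_eq)
  then show False by presburger
qed

lemma independent_eq:
  "ev P + ev Q * y = ev P' + ev Q' * y \<longleftrightarrow> P = P' \<and> Q = Q'"
  using independent[of "P - P'" "Q - Q'"] by (auto simp: algebra_simps)

definition E :: "'f set" where
  "E = adjoin \<iota> {x, y}"

sublocale E: subfield E
  unfolding E_def by standard (rule adjoin_subfield)

lemma E_gens: "\<iota> c \<in> E" "x \<in> E" "y \<in> E"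
  using adjoin_subfield[where \<iota> = \<iota> and S = "{x, y}"] by (auto simp: E_def)

lemma ev_in_E: "ev p \<in> E"
  unfolding ev_def by (intro E.poly_mem) (auto simp: coeff_map_poly E_gens)

lemma E_elementI:
  assumes "R \<noteq> 0" "ev R * z = ev P + ev Q * y"
  shows "z \<in> E"
proof -
  have "z = (ev P + ev Q * y) / ev R" using assms by (simp add: field_simps)
  then show ?thesis by (simp add: E.mems ev_in_E E_gens)
qed

text \<open>The elements (P(x) + Q(x) y) / R(x) form a field containing the generators. Clearing the
  denominator turns equations in the field into equations between polynomials.\<close>

lemma E_elementE:
  assumes "z \<in> E"
  obtains P Q R where "R \<noteq> 0" "ev R * z = ev P + ev Q * y"
proof -
  let ?F = "{z. \<exists>P Q R. R \<noteq> 0 \<and> ev R * z = ev P + ev Q * y}"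
  have I: "z \<in> ?F" if "R \<noteq> 0" "ev R * z = ev P + ev Q * y" for z P Q R
    using that by blast
  have "is_subfield ?F"
    unfolding is_subfield_def
  proof (intro conjI ballI)
    show "0 \<in> ?F" by (rule I[of 1 _ 0 0]) auto
    show "1 \<in> ?F" by (rule I[of 1 _ 1 0]) auto
  next
    fix z w assume "z \<in> ?F" "w \<in> ?F"
    then obtain P Q R P' Q' R' where 1: "R \<noteq> 0" "ev R * z = ev P + ev Q * y"
      "R' \<noteq> 0" "ev R' * w = ev P' + ev Q' * y" by blast
    have "ev (R * R') * (z + w) = ev R' * (ev R * z) + ev R * (ev R' * w)"
      by (simp add: algebra_simps)
    also have "\<dots> = ev (R' * P + R * P') + ev (R' * Q + R * Q') * y"
      unfolding 1 by (simp add: algebra_simps)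
    finally show "z + w \<in> ?F" by (rule I[rotated]) (use 1 in simp)
    have "ev (R * R') * (z * w) = (ev R * z) * (ev R' * w)"
      by (simp add: algebra_simps)
    also have "\<dots> = ev P * ev P' + ev Q * ev Q' * y\<^sup>2 + ev (P * Q' + Q * P') * y"
      unfolding 1 by (simp add: algebra_simps power2_eq_square)
    also have "\<dots> = ev (P * P' + Q * Q' * f) + ev (P * Q' + Q * P') * y"
      by (simp add: y_sq)
    finally show "z * w \<in> ?F" by (rule I[rotated]) (use 1 in simp)
  next
    fix z assume "z \<in> ?F"
    then obtain P Q R where 1: "R \<noteq> 0" "ev R * z = ev P + ev Q * y" by blast
    have "ev R * (- z) = ev (-P) + ev (-Q) * y" using 1 by simp
    then show "- z \<in> ?F" by (rule I[OF 1(1)])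
    show "inverse z \<in> ?F"
    proof (cases "z = 0")
      case True
      then show ?thesis by (intro I[of 1 _ 0 0]) auto
    next
      case False
      \<comment> \<open>The norm of P + Q y over k(x): the inverse is the conjugate P - Q y divided
        by the norm.\<close>
      let ?N = "P\<^sup>2 - Q\<^sup>2 * f"
      have "ev P + ev Q * y \<noteq> 0" using 1 False by (metis ev_eq_0_iff mult_eq_0_iff)
      then have "ev P + ev (- Q) * y \<noteq> 0"
        using independent[of P "- Q"] by auto
      have "ev ?N = ev P ^ 2 - ev Q ^ 2 * y\<^sup>2" by (simp add: y_sq)
      also have "\<dots> = (ev P + ev Q * y) * (ev P + ev (- Q) * y)"
        by (simp add: algebra_simps power2_eq_square)
      finally have N: "ev ?N = (ev P + ev Q * y) * (ev P + ev (- Q) * y)" .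
      then have "ev ?N \<noteq> 0"
        using \<open>ev P + ev Q * y \<noteq> 0\<close> \<open>ev P + ev (- Q) * y \<noteq> 0\<close> by simp
      then have "?N \<noteq> 0" using ev_eq_0_iff by blast
      moreover have "ev ?N * inverse z = ev (R * P) + ev (- R * Q) * y"
        unfolding N 1(2)[symmetric] using False by (simp add: field_simps)
      ultimately show ?thesis by (rule I)
    qed
  qed
  moreover have "range \<iota> \<subseteq> ?F"
  proof safe
    fix c show "\<exists>P Q R. R \<noteq> 0 \<and> ev R * \<iota> c = ev P + ev Q * y"
      by (intro exI[of _ "[:c:]"] exI[of _ 0] exI[of _ 1]) (simp add: ev_pCons)
  qed
  moreover have "x \<in> ?F" by (rule I[of 1 _ "[:0, 1:]" 0]) (auto simp: ev_pCons)
  moreover have "y \<in> ?F" by (rule I[of 1 _ 0 1]) auto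
  ultimately have "E \<subseteq> ?F" unfolding E_def by (intro adjoin_least) auto
  with assms that show ?thesis by blast
qed

text \<open>Membership in k(x) with the denominator cleared. An element of \<open>E\<close> that is
  not rational has degree 2 over k(x).\<close>

definition rational :: "'f \<Rightarrow> bool" where
  "rational z \<longleftrightarrow> (\<exists>P R. R \<noteq> 0 \<and> ev R * z = ev P)"

lemma rationalI: "R \<noteq> 0 \<Longrightarrow> ev R * z = ev P \<Longrightarrow> rational z"
  by (auto simp: rational_def)

text \<open>With R w = P + Q y, the square of \<open>w\<close> has y-component proportional to 2 P
  Q, which must vanish. Since \<open>w\<close> is not rational, P = 0, and \<open>D\<close> lies in
  the square class of \<open>f\<close>.\<close>

lemma sqrt_quartic:
  assumes "w \<in> E" "w\<^sup>2 = ev D" "\<not> rational w" "degree D \<le> 4"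
  obtains c where "c \<noteq> 0" "D = smult c f"
proof -
  obtain P Q R where 1: "R \<noteq> 0" "ev R * w = ev P + ev Q * y"
    using E_elementE[OF assms(1)] .
  have Q: "Q \<noteq> 0"
  proof
    assume "Q = 0"
    with 1 have "rational w" by (intro rationalI[of R]) auto
    with assms(3) show False by contradiction
  qed
  have "ev (R\<^sup>2 * D) = (ev R * w)\<^sup>2" by (simp add: assms(2) power_mult_distrib)
  also have "\<dots> = ev P ^ 2 + ev Q ^ 2 * y\<^sup>2 + ev (2 * P * Q) * y"
    unfolding 1 by (simp add: power2_eq_square algebra_simps)
  also have "\<dots> = ev (P\<^sup>2 + Q\<^sup>2 * f) + ev (2 * P * Q) * y" by (simp add: y_sq)
  finally have "ev (R\<^sup>2 * D) + ev 0 * y = \<dots>" by simp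
  then have "R\<^sup>2 * D = P\<^sup>2 + Q\<^sup>2 * f" "2 * P * Q = 0"
    unfolding independent_eq by auto
  with Q have "R\<^sup>2 * D = Q\<^sup>2 * f" by auto
  from square_times_f_quartic[OF 1(1) Q this assms(4)] that show ?thesis by blast
qed

lemma quadratic_relation:
  assumes "z \<in> E"
  obtains A B C where "A \<noteq> 0" "ev A * z\<^sup>2 + ev B * z + ev C = 0"
proof -
  obtain P Q R where 1: "R \<noteq> 0" "ev R * z = ev P + ev Q * y"
    using E_elementE[OF assms(1)] .
  have "ev R * z - ev P = ev Q * y" using 1 by simp
  then have "(ev R * z - ev P)\<^sup>2 = ev Q ^ 2 * ev f"
    by (simp add: power_mult_distrib y_sq)
  then have "ev (R\<^sup>2) * z\<^sup>2 + ev (- 2 * P * R) * z + ev (P\<^sup>2 - Q\<^sup>2 * f) = 0"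
    by (simp add: power2_eq_square algebra_simps)
  then show ?thesis by (rule that[rotated]) (use 1 in simp)
qed

section \<open>Bidegree of the minimal relation\<close>

text \<open>Here S stands for \<open>x\<close> and T for \<open>z\<close>. The primitive part of a
  minimal relation \<open>G\<close> divides any other relation \<open>H\<close>, so it inherits the
  bound on the degree in S while keeping its degree in T.\<close>

lemma degree_bound_relation:
  assumes "G \<noteq> 0" "degree G > 0" "poly (map_poly ev G) z = 0"
    and minimal: "\<And>R. poly (map_poly ev R) z = 0 \<Longrightarrow> degree R < degree G \<Longrightarrow> R = 0"
    and "H \<noteq> 0" "poly (map_poly ev H) z = 0" "\<And>i. degree (coeff H i) \<le> n"
  obtains G' where "degree G' = degree G" "poly (map_poly ev G') z = 0"
    "\<And>i. degree (coeff G' i) \<le> n"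
proof -
  obtain D G' where D: "D \<noteq> 0" "G = smult D G'" "primitive_poly G'"
    using primitive_part_exists[OF assms(1)] .
  have deg: "degree G' = degree G" using D by simp
  have root: "poly (map_poly ev G') z = 0"
    using assms(3) D by (simp add: ev.map_poly_smult)
  have "G' dvd H"
    by (rule minimal_relation_dvd[OF ev.unital_ring_hom_axioms _ D(3)])
      (use assms deg root in auto)
  then have "degree (coeff G' i) \<le> n" for i
    using coeff_degree_le_of_dvd assms(5,7) by blast
  with deg root that show ?thesis by blast
qed

lemma rational_relation_bound:
  assumes "rational z" "H \<noteq> 0" "poly (map_poly ev H) z = 0" "\<And>i. degree (coeff H i) \<le> n"
  obtains P R where "R \<noteq> 0" "ev R * z = ev P" "degree P \<le> n" "degree R \<le> n"
proof -
  obtain P R where 1: "R \<noteq> 0" "ev R * z = ev P" using assms(1) by (auto simp: rational_def)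
  let ?G = "[:- P, R:]"
  have min: "S = 0" if "poly (map_poly ev S) z = 0" "degree S < degree ?G" for S
  proof -
    have "degree S = 0" using that(2) 1(1) by simp
    then obtain s where "S = [:s:]" by (rule degree_eq_zeroE)
    with that(1) show ?thesis by (simp add: ev.map_poly_pCons_hom)
  qed
  have "?G \<noteq> 0" "degree ?G > 0" "poly (map_poly ev ?G) z = 0"
    using 1 by (simp_all add: ev.map_poly_pCons_hom algebra_simps)
  from degree_bound_relation[OF this min assms(2-4)]
  obtain G' where G': "degree G' = degree ?G" "poly (map_poly ev G') z = 0"
    "\<And>i. degree (coeff G' i) \<le> n" by blast
  have "degree G' = 1" using G'(1) 1 by simp
  then obtain p r where pr: "G' = [:p, r:]" "r \<noteq> 0"
    by (metis One_nat_def degree_pCons_eq_if degree_eq_zeroE nat.distinct(1) nat.inject pCons_cases pCons_eq_0_iff)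
  show ?thesis
  proof (rule that[of r "- p"])
    show "ev r * z = ev (- p)" using G'(2) pr by (simp add: ev.map_poly_pCons_hom algebra_simps eq_neg_iff_add_eq_0)
  qed (use pr G'(3)[of 0] G'(3)[of 1] in auto)
qed

lemma quadratic_relation_bound:
  assumes "z \<in> E" "\<not> rational z"
    and "H \<noteq> 0" "poly (map_poly ev H) z = 0" "\<And>i. degree (coeff H i) \<le> n"
  obtains A B C where "A \<noteq> 0" "ev A * z\<^sup>2 + ev B * z + ev C = 0"
    "degree A \<le> n" "degree B \<le> n" "degree C \<le> n"
proof -
  obtain A B C where 1: "A \<noteq> 0" "ev A * z\<^sup>2 + ev B * z + ev C = 0"
    using quadratic_relation[OF assms(1)] .
  let ?G = "[:C, B, A:]"
  \<comment> \<open>A nonzero relation of degree at most 1 would express \<open>z\<close> as an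
    element of k(x).\<close>
  have min: "S = 0" if "poly (map_poly ev S) z = 0" "degree S < degree ?G" for S
  proof -
    have "degree S \<le> 1" using that(2) 1(1) by simp
    then have S: "S = [:coeff S 0, coeff S 1:]"
      by (intro poly_eqI) (auto simp: coeff_pCons coeff_eq_0 split: nat.splits)
    have "ev (coeff S 1) * z = ev (- coeff S 0)"
      using that(1) by (subst (asm) S) (simp add: ev.map_poly_pCons_hom eq_neg_iff_add_eq_0 algebra_simps)
    with assms(2) have "coeff S 1 = 0" unfolding rational_def by blast
    with \<open>ev (coeff S 1) * z = ev (- coeff S 0)\<close> have "coeff S 0 = 0" by simp
    with \<open>coeff S 1 = 0\<close> S show ?thesis by simp
  qed
  have "?G \<noteq> 0" "degree ?G > 0" "poly (map_poly ev ?G) z = 0"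
    using 1 by (simp_all add: ev.map_poly_pCons_hom algebra_simps power2_eq_square)
  from degree_bound_relation[OF this min assms(3-5)]
  obtain G' where G': "degree G' = degree ?G" "poly (map_poly ev G') z = 0"
    "\<And>i. degree (coeff G' i) \<le> n" by blast
  have d: "degree G' = 2" using G'(1) 1 by simp
  then have eq: "G' = [:coeff G' 0, coeff G' 1, coeff G' 2:]"
    by (intro poly_eqI) (auto simp: coeff_pCons coeff_eq_0 numeral_2_eq_2 split: nat.splits)
  show ?thesis
  proof (rule that[of "coeff G' 2" "coeff G' 1" "coeff G' 0"])
    show "coeff G' 2 \<noteq> 0" using d by (metis degree_0 leading_coeff_0_iff zero_neq_numeral)
    show "ev (coeff G' 2) * z\<^sup>2 + ev (coeff G' 1) * z + ev (coeff G' 0) = 0"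
      using G'(2) by (subst (asm) eq) (simp add: ev.map_poly_pCons_hom algebra_simps power2_eq_square)
  qed (use G'(3) in auto)
qed

lemma y_not_rational: "\<not> rational y"
  using independent_eq[of 0 _ _ 0] by (auto simp: rational_def)

end

section \<open>Two Weierstrass models of the same field\<close>

text \<open>\<open>\<alpha>(T) S\<^sup>2 + \<beta>(T) S + \<gamma>(T)\<close>, rewritten as a polynomial in \<open>T\<close> over \<open>k[S]\<close>.\<close>

definition swap_quadratic :: "'k::comm_ring_1 poly \<Rightarrow> 'k poly \<Rightarrow> 'k poly \<Rightarrow> 'k poly poly" where
  "swap_quadratic \<alpha> \<beta> \<gamma> = smult [:0, 0, 1:] (map_poly (\<lambda>c. [:c:]) \<alpha>)
     + smult [:0, 1:] (map_poly (\<lambda>c. [:c:]) \<beta>) + map_poly (\<lambda>c. [:c:]) \<gamma>"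

lemma coeff_swap_quadratic:
  "coeff (swap_quadratic \<alpha> \<beta> \<gamma>) i = [:coeff \<gamma> i, coeff \<beta> i, coeff \<alpha> i:]"
  by (simp add: swap_quadratic_def coeff_map_poly)

lemma swap_quadratic_eq_0_iff: "swap_quadratic \<alpha> \<beta> \<gamma> = 0 \<longleftrightarrow> \<alpha> = 0 \<and> \<beta> = 0 \<and> \<gamma> = 0"
  by (auto simp: poly_eq_iff[of "swap_quadratic _ _ _"] coeff_swap_quadratic poly_eq_iff[of \<alpha>]
      poly_eq_iff[of \<beta>] poly_eq_iff[of \<gamma>])

lemma degree_le_2_eq:
  assumes "degree p \<le> 2"
  shows "p = [:coeff p 0, coeff p 1, coeff p 2:]"
  using assms
  by (intro poly_eqI) (auto simp: coeff_pCons coeff_eq_0 numeral_2_eq_2 split: nat.splits)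

lemma degree_le_1_eq:
  assumes "degree p \<le> 1"
  shows "p = [:coeff p 0, coeff p 1:]"
  using assms by (intro poly_eqI) (auto simp: coeff_pCons coeff_eq_0 split: nat.splits)

lemma degree_discriminant_le:
  fixes A B C :: "'k::comm_ring_1 poly"
  assumes "degree A \<le> n" "degree B \<le> n" "degree C \<le> n"
  shows "degree (B\<^sup>2 - 4 * A * C) \<le> 2 * n"
proof (rule degree_diff_le)
  show "degree (B\<^sup>2) \<le> 2 * n"
    using degree_power_le[of B 2] assms(2) by simp
  have "4 * A * C = smult 4 (A * C)" by (simp add: numeral_poly)
  then show "degree (4 * A * C) \<le> 2 * n"
    using degree_smult_le[of 4 "A * C"] degree_mult_le[of A C] assms(1,3) by simp
qed

context weierstrass_curve
begin

text \<open>A relation of degree at most 2 for \<open>x\<close> over k[z] becomes a relation for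
  \<open>z\<close> over k[x] whose coefficients have degree at most 2.\<close>

lemma eval_swap_quadratic:
  "poly (map_poly ev (swap_quadratic \<alpha> \<beta> \<gamma>)) z
    = poly (map_poly \<iota> \<alpha>) z * x\<^sup>2 + poly (map_poly \<iota> \<beta>) z * x + poly (map_poly \<iota> \<gamma>) z"
proof -
  interpret e: unital_ring_hom "\<lambda>p. poly (map_poly ev p) z" by (rule ev.eval_hom)
  have "map_poly ev (map_poly (\<lambda>c. [:c:]) p) = map_poly \<iota> p" for p
    by (intro poly_eqI) (simp add: coeff_map_poly ev_pCons)
  then show ?thesis
    by (simp add: swap_quadratic_def ev.map_poly_smult ev_pCons algebra_simps power2_eq_square)
qed

text \<open>Completing the square: 2 A z + B is a square root of the discriminant and, like
  \<open>z\<close>, does not lie in k(x), so \<open>sqrt_quartic\<close> applies.\<close>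

lemma discriminant_of_relation:
  assumes "z \<in> E" "\<not> rational z" "A \<noteq> 0" "ev A * z\<^sup>2 + ev B * z + ev C = 0"
    and "degree (B\<^sup>2 - 4 * A * C) \<le> 4"
  obtains c where "c \<noteq> 0" "B\<^sup>2 - 4 * A * C = smult c f"
proof -
  define w where "w = ev (2 * A) * z + ev B"
  have "w\<^sup>2 = 4 * ev A * (ev A * z\<^sup>2 + ev B * z + ev C) + ev B ^ 2 - 4 * ev A * ev C"
    by (simp add: w_def power2_eq_square algebra_simps)
  then have w2: "w\<^sup>2 = ev (B\<^sup>2 - 4 * A * C)" using assms(4) by simp
  have "\<not> rational w"
  proof
    assume "rational w"
    then obtain P R where "R \<noteq> 0" "ev R * w = ev P" by (auto simp: rational_def)
    then have "ev (R * (2 * A)) * z = ev (P - R * B)" by (simp add: w_def algebra_simps)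
    moreover have "R * (2 * A) \<noteq> 0" using assms(3) \<open>R \<noteq> 0\<close> by simp
    ultimately show False using assms(2) rationalI by blast
  qed
  moreover have "w \<in> E" unfolding w_def by (intro E.add_mem E.mult_mem ev_in_E assms(1))
  ultimately show ?thesis using sqrt_quartic[OF _ w2 _ assms(5)] that by blast
qed

end

text \<open>If \<open>x\<close> lies in k(x') but x' has degree 2 over k(x), the minimal relation is
  linear in \<open>x\<close>. Its discriminant then has degree at most 2, yet it must be a nonzero
  multiple of a cubic.\<close>

lemma rational_symmetric:
  assumes "weierstrass_curve \<iota> x y a b" "weierstrass_curve \<iota> x' y' a' b'"
    and "adjoin \<iota> {x, y} = adjoin \<iota> {x', y'}"
    and "weierstrass_curve.rational \<iota> x' x"
  shows "weierstrass_curve.rational \<iota> x x'"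
proof (rule ccontr)
  interpret A: weierstrass_curve \<iota> x y a b by fact
  interpret B: weierstrass_curve \<iota> x' y' a' b' by fact
  assume nr: "\<not> A.rational x'"
  have "x' \<in> A.E" using B.E_gens assms(3) by (simp add: A.E_def B.E_def)
  obtain P R where PR: "R \<noteq> 0" "B.ev R * x = B.ev P" using assms(4) by (auto simp: B.rational_def)
  define H where "H = swap_quadratic 0 R (- P)"
  have "H \<noteq> 0" using PR by (simp add: H_def swap_quadratic_eq_0_iff)
  moreover have "poly (map_poly A.ev H) x' = 0"
    unfolding H_def A.eval_swap_quadratic using PR by (simp flip: B.ev_def)
  moreover have "degree (coeff H i) \<le> 1" for i by (simp add: H_def coeff_swap_quadratic)
  ultimately obtain A B C where *: "A \<noteq> 0" "A.ev A * x'\<^sup>2 + A.ev B * x' + A.ev C = 0"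
    "degree A \<le> 1" "degree B \<le> 1" "degree C \<le> 1"
    using A.quadratic_relation_bound[OF \<open>x' \<in> A.E\<close> nr] by metis
  have deg: "degree (B\<^sup>2 - 4 * A * C) \<le> 2" using degree_discriminant_le[OF *(3-5)] by simp
  then obtain c where "c \<noteq> 0" "B\<^sup>2 - 4 * A * C = smult c A.f"
    using A.discriminant_of_relation[OF \<open>x' \<in> A.E\<close> nr *(1,2)] by auto
  with deg show False by (simp add: A.f_props)
qed

lemma quartic_I_J_eq_imp_ratio_eq:
  fixes a b a' b' c d :: "'k::{idom, ring_char_0}"
  assumes "c \<noteq> 0" "d \<noteq> 0" "- 3 * (c\<^sup>2 * a) = - 3 * (d\<^sup>2 * a')" "- 27 * (c ^ 3 * b) = - 27 * (d ^ 3 * b')"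
  shows "a ^ 3 * b'\<^sup>2 = a' ^ 3 * b\<^sup>2"
  using weighted_ratio_eq[of c d a a' b b'] assms by simp

lemma ratio_eq_of_same_field:
  assumes "weierstrass_curve \<iota> x y a b" "weierstrass_curve \<iota> x' y' a' b'"
    and same: "adjoin \<iota> {x, y} = adjoin \<iota> {x', y'}"
  shows "a ^ 3 * b'\<^sup>2 = a' ^ 3 * b\<^sup>2"
proof -
  interpret A: weierstrass_curve \<iota> x y a b by fact
  interpret B: weierstrass_curve \<iota> x' y' a' b' by fact
  have E: "A.E = B.E" using same by (simp add: A.E_def B.E_def)
  have mem: "x' \<in> A.E" "y' \<in> A.E" "x \<in> B.E" "y \<in> B.E"
    using A.E_gens B.E_gens E by auto
  show ?thesis
  proof (cases "A.rational x'")
    case False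
    have nB: "\<not> B.rational x" using False rational_symmetric[OF assms] by blast
    \<comment> \<open>The quadratic relation of \<open>x\<close> over k(x') bounds the degree in
      \<open>x\<close> of the minimal relation of x' over k(x), which thus has bidegree at most
      (2,2).\<close>
    obtain \<alpha> \<beta> \<gamma> where "\<alpha> \<noteq> 0" "B.ev \<alpha> * x\<^sup>2 + B.ev \<beta> * x + B.ev \<gamma> = 0"
      using B.quadratic_relation[OF mem(3)] .
    define H where "H = swap_quadratic \<alpha> \<beta> \<gamma>"
    have "H \<noteq> 0" using \<open>\<alpha> \<noteq> 0\<close> by (simp add: H_def swap_quadratic_eq_0_iff)
    moreover have "poly (map_poly A.ev H) x' = 0"
      unfolding H_def A.eval_swap_quadratic using \<open>_ = 0\<close> by (simp flip: B.ev_def)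
    moreover have "degree (coeff H i) \<le> 2" for i by (simp add: H_def coeff_swap_quadratic)
    ultimately obtain A B C where *: "A \<noteq> 0" "A.ev A * x'\<^sup>2 + A.ev B * x' + A.ev C = 0"
      "degree A \<le> 2" "degree B \<le> 2" "degree C \<le> 2"
      using A.quadratic_relation_bound[OF mem(1) False] by metis
    obtain A0 A1 A2 B0 B1 B2 C0 C1 C2
      where coeffs: "A = [:A0, A1, A2:]" "B = [:B0, B1, B2:]" "C = [:C0, C1, C2:]"
      using *(3-5)[THEN degree_le_2_eq] by blast
    have "degree (B\<^sup>2 - 4 * A * C) \<le> 4" using degree_discriminant_le[OF *(3-5)] by simp
    then obtain c where c: "c \<noteq> 0" "B\<^sup>2 - 4 * A * C = smult c A.f"
      using A.discriminant_of_relation[OF mem(1) False *(1,2)] by blast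
    \<comment> \<open>The columns of the coefficient matrix: the same form, read as a quadratic in
      \<open>x\<close> over k[x'].\<close>
    let ?A = "[:C2, B2, A2:]" and ?B = "[:C1, B1, A1:]" and ?C = "[:C0, B0, A0:]"
    have rel: "B.ev ?A * x\<^sup>2 + B.ev ?B * x + B.ev ?C = 0"
      using *(2) by (simp add: coeffs A.ev_pCons B.ev_pCons algebra_simps power2_eq_square)
    \<comment> \<open>Without a quadratic term, either \<open>x\<close> would be rational over k(x')
      or the whole form would vanish.\<close>
    have "?A \<noteq> 0"
    proof
      assume "?A = 0"
      then have "B.ev ?B * x = B.ev (- ?C)" using rel
        by (simp only: B.ev.zero B.ev.uminus) (simp add: eq_neg_iff_add_eq_0)
      with nB B.rationalI have "?B = 0" by blast
      with \<open>?A = 0\<close> rel have "?C = 0" by (simp only: B.ev.zero) simp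
      with \<open>?A = 0\<close> \<open>?B = 0\<close> *(1) coeffs show False by simp
    qed
    moreover have "degree (?B\<^sup>2 - 4 * ?A * ?C) \<le> 4"
      using degree_discriminant_le[of ?A 2 ?B ?C] by simp
    ultimately obtain d where d: "d \<noteq> 0" "?B\<^sup>2 - 4 * ?A * ?C = smult d B.f"
      using B.discriminant_of_relation[OF mem(3) nB _ rel] by blast
    have "quartic_I (smult c A.f) = quartic_I (smult d B.f)"
      "quartic_J (smult c A.f) = quartic_J (smult d B.f)"
      using quartic_invariants_discriminants[of B0 B1 B2 A0 A1 A2 C0 C1 C2] c(2) d(2)
      unfolding coeffs by simp_all
    then show ?thesis
      unfolding quartic_invariants_weierstrass
      using quartic_I_J_eq_imp_ratio_eq[OF c(1) d(1)] by blast
  next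
    case True
    have "B.rational x" using True rational_symmetric[OF assms(2,1)] same by simp
    then obtain P0 R0 where PR: "R0 \<noteq> 0" "B.ev R0 * x = B.ev P0" by (auto simp: B.rational_def)
    define H where "H = swap_quadratic 0 R0 (- P0)"
    have "H \<noteq> 0" using PR by (simp add: H_def swap_quadratic_eq_0_iff)
    moreover have "poly (map_poly A.ev H) x' = 0"
      unfolding H_def A.eval_swap_quadratic using PR by (simp flip: B.ev_def)
    moreover have "degree (coeff H i) \<le> 1" for i by (simp add: H_def coeff_swap_quadratic)
    ultimately obtain p r where pr: "r \<noteq> 0" "A.ev r * x' = A.ev p" "degree p \<le> 1" "degree r \<le> 1"
      using A.rational_relation_bound[OF True] by metis
    obtain p0 p1 r0 r1 where coeffs: "p = [:p0, p1:]" "r = [:r0, r1:]"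
      using pr(3,4)[THEN degree_le_1_eq] by blast
    \<comment> \<open>Now x' = p / r is a Moebius transform of \<open>x\<close>. Multiplying the
      second curve equation by r^4 makes \<open>w\<close> a square root of the quartic
      \<open>q\<close>.\<close>
    define q where "q = r * (p ^ 3 + smult a' (p * r\<^sup>2) + smult b' (r ^ 3))"
    define w where "w = A.ev (r\<^sup>2) * y'"
    have smult: "A.ev (smult c s) = \<iota> c * A.ev s" for c s
      using A.ev.mult[of "[:c:]" s] by (simp add: A.ev_pCons)
    have "w\<^sup>2 = A.ev r ^ 4 * (x' ^ 3 + \<iota> a' * x' + \<iota> b')"
      by (simp add: w_def power_mult_distrib B.curve_eq)
    also have "\<dots> = A.ev r * ((A.ev r * x') ^ 3 + \<iota> a' * ((A.ev r * x') * (A.ev r)\<^sup>2) + \<iota> b' * A.ev r ^ 3)"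
      by algebra
    also have "\<dots> = A.ev q" by (simp add: pr(2) q_def smult)
    finally have w2: "w\<^sup>2 = A.ev q" .
    have "w \<in> A.E" using mem by (auto simp: w_def intro!: A.E.mems A.ev_in_E)
    have nr: "\<not> A.rational w"
    proof
      assume "A.rational w"
      then obtain P R where R: "R \<noteq> 0" "A.ev R * w = A.ev P" by (auto simp: A.rational_def)
      \<comment> \<open>\<open>?F\<close> is k(x). If \<open>w\<close> were in it, so would be y',
        and x' already is; then the whole field would lie in k(x), which does not contain
        \<open>y\<close>.\<close>
      let ?F = "{z. A.rational z}"
      \<comment> \<open>Division by 0 yields 0, so \<open>T = 0\<close> is allowed; this also covers
        the inverse of 0 below.\<close>
      have I: "A.rational (A.ev S / A.ev T)" for S T
        by (cases "T = 0") (auto intro: A.rationalI[of T _ S] A.rationalI[of 1 _ 0])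
      have D: "\<exists>S T. z = A.ev S / A.ev T \<and> T \<noteq> 0" if "A.rational z" for z
        using that unfolding A.rational_def
        by (metis A.ev_eq_0_iff nonzero_mult_div_cancel_left)
      have "is_subfield ?F"
        unfolding is_subfield_def
      proof (intro conjI ballI)
        show "0 \<in> ?F" "1 \<in> ?F" using I[of 0 1] I[of 1 1] by simp_all
        fix z z' assume "z \<in> ?F" "z' \<in> ?F"
        then obtain S T S' T' where *: "z = A.ev S / A.ev T" "T \<noteq> 0" "z' = A.ev S' / A.ev T'" "T' \<noteq> 0"
          using D by (metis mem_Collect_eq)
        show "z + z' \<in> ?F" using * I[of "S * T' + S' * T" "T * T'"] by (simp add: add_frac_eq)
        show "z * z' \<in> ?F" using * I[of "S * S'" "T * T'"] by simp
      next
        fix z assume "z \<in> ?F"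
        then obtain S T where *: "z = A.ev S / A.ev T" "T \<noteq> 0" using D by (metis mem_Collect_eq)
        show "- z \<in> ?F" using * I[of "- S" T] by simp
        show "inverse z \<in> ?F" using * I[of T S] by simp
      qed
      moreover have "range \<iota> \<subseteq> ?F"
      proof safe
        fix c show "A.rational (\<iota> c)" using I[of "[:c:]" 1] by (simp add: A.ev_pCons)
      qed
      moreover have "A.ev (R * r\<^sup>2) * y' = A.ev P" using R by (simp add: w_def mult.assoc)
      then have "A.rational y'" using R pr(1) A.rationalI[of "R * r\<^sup>2"] by simp
      ultimately have "B.E \<subseteq> ?F" using True unfolding B.E_def by (intro adjoin_least) auto
      with mem(4) A.y_not_rational show False by auto
    qed
    have "degree q \<le> 4"
      unfolding q_def coeffs
      by (simp add: power2_eq_square power3_eq_cube)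
    then obtain c where c: "c \<noteq> 0" "q = smult c A.f"
      using A.sqrt_quartic[OF \<open>w \<in> A.E\<close> w2 nr] by blast
    define d where "d = (p1 * r0 - p0 * r1)\<^sup>2"
    have eqs: "- 3 * (c\<^sup>2 * a) = - 3 * (d\<^sup>2 * a')" "- 27 * (c ^ 3 * b) = - 27 * (d ^ 3 * b')"
      using quartic_invariants_moebius[of r0 r1 p0 p1 a' b'] quartic_invariants_weierstrass[of c a b]
      unfolding d_def c(2)[symmetric] q_def coeffs by simp_all
    \<comment> \<open>A vanishing determinant would make both invariants of \<open>c f\<close>
      vanish, forcing the singular case a = b = 0.\<close>
    have "d \<noteq> 0"
    proof
      assume "d = 0"
      with eqs c have "a = 0" "b = 0" by simp_all
      with A.nonsing show False by simp
    qed
    with eqs show ?thesis using quartic_I_J_eq_imp_ratio_eq[OF c(1)] by blast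
  qed
qed

section \<open>Isomorphisms\<close>

text \<open>\<open>rel\<close> pairs the elements with the same coordinates P, Q, R on both curves;
  it is the graph of the isomorphism.\<close>

lemma isomorphic_over_of_same_equation:
  fixes \<iota> :: "'k::{alg_closed_field, field_char_0} \<Rightarrow> 'f::field"
  assumes "weierstrass_curve \<iota> x y a b" "weierstrass_curve \<iota> x' y' a b"
  shows "isomorphic_over \<iota> (adjoin \<iota> {x, y}) (adjoin \<iota> {x', y'})"
proof -
  interpret A: weierstrass_curve \<iota> x y a b by fact
  interpret B: weierstrass_curve \<iota> x' y' a b by fact
  define rel where "rel z z' \<longleftrightarrow> (\<exists>P Q R. R \<noteq> 0 \<and> A.ev R * z = A.ev P + A.ev Q * y
    \<and> B.ev R * z' = B.ev P + B.ev Q * y')" for z z'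
  have relI: "rel z z'" if "R \<noteq> 0" "A.ev R * z = A.ev P + A.ev Q * y"
    "B.ev R * z' = B.ev P + B.ev Q * y'" for z z' P Q R
    using that by (auto simp: rel_def)
  have mem: "z \<in> A.E" "z' \<in> B.E" if "rel z z'" for z z'
    using that A.E_elementI B.E_elementI by (auto simp: rel_def)
  have total: "\<exists>z'. rel z z'" if z: "z \<in> A.E" for z
  proof -
    obtain P Q R where "R \<noteq> 0" "A.ev R * z = A.ev P + A.ev Q * y" using A.E_elementE[OF z] .
    then show ?thesis
      by (intro exI[of _ "(B.ev P + B.ev Q * y') / B.ev R"] relI) auto
  qed
  have onto: "\<exists>z. rel z z'" if z: "z' \<in> B.E" for z'
  proof -
    obtain P Q R where "R \<noteq> 0" "B.ev R * z' = B.ev P + B.ev Q * y'" using B.E_elementE[OF z] .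
    then show ?thesis
      by (intro exI[of _ "(A.ev P + A.ev Q * y) / A.ev R"] relI) auto
  qed
  \<comment> \<open>Equality of two elements is a condition on their coordinates alone, hence the
    same on both curves. This makes \<open>rel\<close> both single-valued and injective.\<close>
  have cross: "z = w \<longleftrightarrow> R' * P = R * P' \<and> R' * Q = R * Q'"
    if "weierstrass_curve \<iota> x y a b" "R \<noteq> 0" "R' \<noteq> 0"
      "weierstrass_curve.ev \<iota> x R * z = weierstrass_curve.ev \<iota> x P + weierstrass_curve.ev \<iota> x Q * y"
      "weierstrass_curve.ev \<iota> x R' * w = weierstrass_curve.ev \<iota> x P' + weierstrass_curve.ev \<iota> x Q' * y"
    for x y z w P Q R P' Q' R'
  proof -
    interpret C: weierstrass_curve \<iota> x y a b by fact
    have "z = w \<longleftrightarrow> C.ev R' * (C.ev R * z) = C.ev R * (C.ev R' * w)"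
      using that(2,3) by (simp add: mult.left_commute)
    also have "\<dots> \<longleftrightarrow> C.ev (R' * P) + C.ev (R' * Q) * y = C.ev (R * P') + C.ev (R * Q') * y"
      unfolding that(4,5) by (simp add: algebra_simps)
    finally show ?thesis unfolding C.independent_eq .
  qed
  have unique: "z = w \<longleftrightarrow> z' = w'" if rel: "rel z z'" "rel w w'" for z z' w w'
  proof -
    obtain P Q R where 1: "R \<noteq> 0" "A.ev R * z = A.ev P + A.ev Q * y"
      "B.ev R * z' = B.ev P + B.ev Q * y'" using rel(1) by (auto simp: rel_def)
    obtain P' Q' R' where 2: "R' \<noteq> 0" "A.ev R' * w = A.ev P' + A.ev Q' * y"
      "B.ev R' * w' = B.ev P' + B.ev Q' * y'" using rel(2) by (auto simp: rel_def)
    show ?thesis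
      using cross[OF assms(1) 1(1) 2(1) 1(2) 2(2)] cross[OF assms(2) 1(1) 2(1) 1(3) 2(3)] by simp
  qed
  have rel_add: "rel (z + w) (z' + w')" and rel_mult: "rel (z * w) (z' * w')"
    if rel: "rel z z'" "rel w w'" for z z' w w'
  proof -
    obtain P Q R where 1: "R \<noteq> 0" "A.ev R * z = A.ev P + A.ev Q * y"
      "B.ev R * z' = B.ev P + B.ev Q * y'" using rel(1) by (auto simp: rel_def)
    obtain P' Q' R' where 2: "R' \<noteq> 0" "A.ev R' * w = A.ev P' + A.ev Q' * y"
      "B.ev R' * w' = B.ev P' + B.ev Q' * y'" using rel(2) by (auto simp: rel_def)
    have alg_add: "r * r' * (s + t) = (r' * p + r * p') + (r' * q + r * q') * v"
      and alg_mult: "r * r' * (s * t) = (p * p' + q * q' * v\<^sup>2) + (p * q' + q * p') * v"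
      if "r * s = p + q * v" "r' * t = p' + q' * v" for r r' s t p p' q q' v :: 'f
      using that by algebra+
    show "rel (z + w) (z' + w')"
      by (rule relI[of "R * R'" _ "R' * P + R * P'" "R' * Q + R * Q'"])
        (use 1 2 alg_add[OF 1(2) 2(2)] alg_add[OF 1(3) 2(3)] in simp_all)
    \<comment> \<open>The common equation enters here: the squares of \<open>y\<close> and y' are
      values of the same cubic.\<close>
    show "rel (z * w) (z' * w')"
      by (rule relI[of "R * R'" _ "P * P' + Q * Q' * A.f" "P * Q' + Q * P'"])
        (use 1 2 alg_mult[OF 1(2) 2(2)] A.y_sq alg_mult[OF 1(3) 2(3)] B.y_sq in simp_all)
  qed
  have rel_const: "rel (\<iota> c) (\<iota> c)" for c
    by (rule relI[of 1 _ "[:c:]" 0]) (simp_all add: A.ev_pCons B.ev_pCons)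
  define \<phi> where "\<phi> z = (SOME z'. rel z z')" for z
  have \<phi>: "rel z (\<phi> z)" if "z \<in> A.E" for z
    unfolding \<phi>_def using total[OF that] by (rule someI_ex)
  have \<phi>_eq: "\<phi> z = z'" if "rel z z'" for z z'
    using unique[OF that \<phi>] mem(1)[OF that] by auto
  have "bij_betw \<phi> A.E B.E"
    unfolding bij_betw_def inj_on_def
  proof (intro conjI ballI impI equalityI subsetI)
    show "z = w" if "z \<in> A.E" "w \<in> A.E" "\<phi> z = \<phi> w" for z w
      using unique[OF \<phi>[OF that(1)] \<phi>[OF that(2)]] that(3) by simp
    show "z \<in> B.E" if "z \<in> \<phi> ` A.E" for z using that mem(2)[OF \<phi>] by auto
    show "z' \<in> \<phi> ` A.E" if "z' \<in> B.E" for z'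
      using onto[OF that] \<phi>_eq mem(1) by (metis imageI)
  qed
  moreover have "\<phi> (z + w) = \<phi> z + \<phi> w \<and> \<phi> (z * w) = \<phi> z * \<phi> w" if "z \<in> A.E" "w \<in> A.E" for z w
    using \<phi>_eq rel_add rel_mult \<phi> that by simp
  moreover have "\<phi> (\<iota> c) = \<iota> c" for c by (rule \<phi>_eq[OF rel_const])
  ultimately show ?thesis
    unfolding isomorphic_over_def A.E_def[symmetric] B.E_def[symmetric] by blast
qed

text \<open>The isomorphism fixes constants, so it commutes with evaluating polynomials over k and
  carries the point (x, y) to a generating point of \<open>F\<close> on the same curve.\<close>

lemma weierstrass_curve_transport:
  assumes "weierstrass_curve \<iota> x y a b" "isomorphic_over \<iota> (adjoin \<iota> {x, y}) F" "is_subfield F"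
  obtains x' y' where "weierstrass_curve \<iota> x' y' a b" "F = adjoin \<iota> {x', y'}"
proof -
  interpret A: weierstrass_curve \<iota> x y a b by fact
  interpret F: subfield F by standard fact
  obtain \<phi> where bij: "bij_betw \<phi> A.E F"
    and hom: "\<And>z w. z \<in> A.E \<Longrightarrow> w \<in> A.E \<Longrightarrow> \<phi> (z + w) = \<phi> z + \<phi> w"
      "\<And>z w. z \<in> A.E \<Longrightarrow> w \<in> A.E \<Longrightarrow> \<phi> (z * w) = \<phi> z * \<phi> w"
    and const: "\<And>c. \<phi> (\<iota> c) = \<iota> c"
    using assms(2) by (auto simp: isomorphic_over_def A.E_def)
  have zero: "\<phi> 0 = 0" and one: "\<phi> 1 = 1" using const[of 0] const[of 1] by simp_all
  have inj: "\<phi> z = \<phi> w \<longleftrightarrow> z = w" if "z \<in> A.E" "w \<in> A.E" for z w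
    using bij that by (auto simp: bij_betw_def inj_on_def)
  have in_F: "\<phi> z \<in> F" if "z \<in> A.E" for z using bij that by (auto simp: bij_betw_def)
  have poly: "\<phi> (A.ev p) = poly (map_poly \<iota> p) (\<phi> x)" for p
  proof (induction p)
    case (pCons c p)
    then show ?case
      by (simp add: A.ev_pCons hom A.E_gens A.ev_in_E A.E.mems const A.emb.map_poly_pCons_hom)
  qed (simp add: zero)
  have "weierstrass_curve \<iota> (\<phi> x) (\<phi> y) a b"
  proof
    show "field_embedding \<iota>" "4 * a ^ 3 + 27 * b\<^sup>2 \<noteq> 0" using A.emb A.nonsing by auto
    show "transcendental_over \<iota> (\<phi> x)"
      unfolding transcendental_over_def
      using poly inj[OF A.ev_in_E A.E.zero_mem] zero by (metis A.ev_eq_0_iff)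
    have "\<phi> (y\<^sup>2) = (\<phi> y)\<^sup>2" by (simp add: power2_eq_square hom A.E_gens)
    moreover have "\<phi> (y\<^sup>2) = poly (map_poly \<iota> A.f) (\<phi> x)" unfolding A.y_sq poly ..
    ultimately show "(\<phi> y)\<^sup>2 = \<phi> x ^ 3 + \<iota> a * \<phi> x + \<iota> b"
      by (simp add: weierstrass_cubic_def A.emb.map_poly_pCons_hom algebra_simps power3_eq_cube)
  qed
  moreover have "F = adjoin \<iota> {\<phi> x, \<phi> y}" (is "F = ?G")
  proof
    interpret G: subfield ?G by standard (rule adjoin_subfield)
    have gen: "\<phi> x \<in> ?G" "\<phi> y \<in> ?G" "\<iota> c \<in> ?G" for c
      using adjoin_subfield[where \<iota> = \<iota> and S = "{\<phi> x, \<phi> y}"] by auto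
    \<comment> \<open>The preimage of \<open>?G\<close> is a subfield containing the constants,
      \<open>x\<close> and \<open>y\<close>, hence everything.\<close>
    let ?H = "{z \<in> A.E. \<phi> z \<in> ?G}"
    have neg: "\<phi> (- z) = - \<phi> z" if "z \<in> A.E" for z
      using hom(1)[of z "- z"] that by (simp add: A.E.mems zero eq_neg_iff_add_eq_0 add.commute)
    have inv: "\<phi> (inverse z) = inverse (\<phi> z)" if "z \<in> A.E" for z
    proof (cases "z = 0")
      case False
      then have "\<phi> z * \<phi> (inverse z) = 1"
        using hom(2)[of z "inverse z"] that by (simp add: A.E.mems one)
      then show ?thesis by (metis inverse_unique)
    qed (simp add: zero)
    have "is_subfield ?H"
      unfolding is_subfield_def by (auto simp: zero one hom neg inv A.E.mems G.mems)
    then have "A.E \<subseteq> ?H"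
      using gen A.E_gens const by (subst A.E_def, intro adjoin_least) auto
    with bij show "F \<subseteq> ?G" by (auto simp: bij_betw_def)
    show "?G \<subseteq> F"
    proof (rule adjoin_least[OF assms(3)])
      show "range \<iota> \<subseteq> F"
      proof safe
        fix c show "\<iota> c \<in> F" using in_F[OF A.E_gens(1)[of c]] const[of c] by simp
      qed
    qed (use in_F A.E_gens in auto)
  qed
  ultimately show ?thesis by (rule that)
qed

section \<open>Transcendental elements and changes of coordinates\<close>

lemma transcendental_over_poly:
  assumes "field_embedding \<iota>" "transcendental_over \<iota> t" "degree q > 0"
  shows "transcendental_over \<iota> (poly (map_poly \<iota> q) t)"
  unfolding transcendental_over_def
proof (intro allI impI)
  interpret unital_ring_hom \<iota> by (rule field_embedding_hom[OF assms(1)])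
  interpret ev: unital_ring_hom "\<lambda>p. poly (map_poly \<iota> p) t" by (rule eval_hom)
  fix p :: "'a poly" assume "p \<noteq> 0"
  have "poly (map_poly \<iota> p) (poly (map_poly \<iota> q) t) = poly (map_poly \<iota> (pcompose p q)) t"
    by (induction p) (simp_all add: pcompose_pCons map_poly_pCons_hom)
  moreover have "pcompose p q \<noteq> 0" using \<open>p \<noteq> 0\<close> assms(3) by (simp add: pcompose_eq_0_iff)
  ultimately show "poly (map_poly \<iota> p) (poly (map_poly \<iota> q) t) \<noteq> 0"
    using assms(2) by (simp add: transcendental_over_def)
qed

text \<open>Multiplying p(1/t) by a power of \<open>t\<close> gives the reflected polynomial at
  \<open>t\<close>, which is nonzero if \<open>p\<close> is.\<close>

lemma transcendental_over_inverse:
  assumes "field_embedding \<iota>" "transcendental_over \<iota> t"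
  shows "transcendental_over \<iota> (inverse t)"
  unfolding transcendental_over_def
proof (intro allI impI)
  interpret unital_ring_hom \<iota> by (rule field_embedding_hom[OF assms(1)])
  fix p :: "'a poly" assume "p \<noteq> 0"
  have inj: "\<iota> c = 0 \<longleftrightarrow> c = 0" for c
    using mult[of c "inverse c"] by (cases "c = 0") auto
  have "t \<noteq> 0"
    using assms(2)[unfolded transcendental_over_def, rule_format, of "[:0, 1:]"]
    by (simp add: map_poly_pCons_hom)
  have deg: "degree (map_poly \<iota> p) = degree p"
    by (rule degree_map_poly) (simp add: inj)
  have "reflect_poly (map_poly \<iota> p) = map_poly \<iota> (reflect_poly p)"
    by (intro poly_eqI) (simp add: coeff_reflect_poly coeff_map_poly deg)
  then have "t ^ degree p * poly (map_poly \<iota> p) (inverse t) = poly (map_poly \<iota> (reflect_poly p)) t"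
    using poly_reflect_poly_nz[OF \<open>t \<noteq> 0\<close>, of "map_poly \<iota> p"] deg by simp
  also have "\<dots> \<noteq> 0"
    using assms(2) \<open>p \<noteq> 0\<close> by (simp add: transcendental_over_def)
  finally show "poly (map_poly \<iota> p) (inverse t) \<noteq> 0" by auto
qed

lemma adjoin_eqI:
  assumes "S \<subseteq> adjoin \<iota> T" "T \<subseteq> adjoin \<iota> S"
  shows "adjoin \<iota> S = adjoin \<iota> T"
  using assms adjoin_least[OF adjoin_subfield(1,2)] by (metis subset_antisym)

text \<open>The substitution (x, y) -> (u^2 x, u^3 y) relates any two models with the same ratio a^3
  : b^2, once roots are available.\<close>

lemma scaling_exists:
  fixes a b a' b' :: "'k::alg_closed_field"
  assumes "4 * a ^ 3 + 27 * b\<^sup>2 \<noteq> 0" "4 * a' ^ 3 + 27 * b'\<^sup>2 \<noteq> 0"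
    and eq: "a ^ 3 * b'\<^sup>2 = a' ^ 3 * b\<^sup>2"
  obtains u where "u \<noteq> 0" "a' = u ^ 4 * a" "b' = u ^ 6 * b"
proof -
  have root: "\<exists>u. u ^ n = c" if "n > 0" for n and c :: 'k
    using nth_root_exists[OF that, of c] by blast
  consider "a = 0" "a' = 0" "b \<noteq> 0" "b' \<noteq> 0" | "b = 0" "b' = 0" "a \<noteq> 0" "a' \<noteq> 0"
    | "a \<noteq> 0" "a' \<noteq> 0" "b \<noteq> 0" "b' \<noteq> 0"
    using assms by (cases "a = 0"; cases "b = 0"; cases "a' = 0"; cases "b' = 0") auto
  then show ?thesis
  proof cases
    case 1
    obtain u where "u ^ 6 = b' / b" using root[of 6] by auto
    with 1 show ?thesis by (intro that[of u]) (auto simp: field_simps)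
  next
    case 2
    obtain u where "u ^ 4 = a' / a" using root[of 4] by auto
    with 2 show ?thesis by (intro that[of u]) (auto simp: field_simps)
  next
    case 3
    \<comment> \<open>The quotient of the desired values b'/b of u^6 and a'/a of u^4.\<close>
    obtain u where u: "u ^ 2 = (b' * a) / (b * a')" using root[of 2] by auto
    have "u ^ 4 = (u ^ 2) ^ 2" by (simp flip: power_mult)
    also have "\<dots> = (a ^ 3 * b'\<^sup>2) / (a * b\<^sup>2 * a'\<^sup>2)"
      using 3 unfolding u by (simp add: field_simps power2_eq_square power3_eq_cube)
    also have "\<dots> = a' / a"
      using 3 unfolding eq by (simp add: field_simps power2_eq_square power3_eq_cube)
    finally have u4: "u ^ 4 = a' / a" .
    have "u ^ 6 = u ^ 4 * u ^ 2" by (simp flip: power_add)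
    also have "\<dots> = b' / b" unfolding u u4 using 3 by (simp add: field_simps)
    finally have "u ^ 6 = b' / b" .
    with u4 3 show ?thesis by (intro that[of u]) (auto simp: field_simps)
  qed
qed

text \<open>An isomorphism moves the first model into the second field, where two models of one
  field are compared. Conversely, the second point is rescaled so that both satisfy the same
  equation.\<close>

lemma isomorphic_over_iff_ratio_eq:
  assumes "weierstrass_curve \<iota> x y a b" "weierstrass_curve \<iota> x' y' a' b'"
  shows "isomorphic_over \<iota> (adjoin \<iota> {x, y}) (adjoin \<iota> {x', y'}) \<longleftrightarrow> a ^ 3 * b'\<^sup>2 = a' ^ 3 * b\<^sup>2"
proof
  interpret A: weierstrass_curve \<iota> x y a b by fact
  interpret B: weierstrass_curve \<iota> x' y' a' b' by fact
  {
    assume "isomorphic_over \<iota> (adjoin \<iota> {x, y}) (adjoin \<iota> {x', y'})"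
    then obtain x1 y1 where "weierstrass_curve \<iota> x1 y1 a b" "adjoin \<iota> {x', y'} = adjoin \<iota> {x1, y1}"
      using weierstrass_curve_transport[OF assms(1)] adjoin_subfield(1) by metis
    then show "a ^ 3 * b'\<^sup>2 = a' ^ 3 * b\<^sup>2"
      using ratio_eq_of_same_field[OF _ assms(2)] by simp
  next
    assume "a ^ 3 * b'\<^sup>2 = a' ^ 3 * b\<^sup>2"
    then obtain u where u: "u \<noteq> 0" "a' = u ^ 4 * a" "b' = u ^ 6 * b"
      using scaling_exists[OF A.nonsing B.nonsing] by blast
    define v where "v = inverse u"
    have "v * u = 1" using u by (simp add: v_def)
    then have uv: "\<iota> v * \<iota> u = 1" by (metis A.emb.mult A.emb.one)
    define x1 y1 where "x1 = \<iota> v ^ 2 * x'" and "y1 = \<iota> v ^ 3 * y'"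
    have "weierstrass_curve \<iota> x1 y1 a b"
    proof
      have "poly (map_poly \<iota> [:0, v\<^sup>2:]) x' = x1"
        by (simp add: A.emb.map_poly_pCons_hom x1_def mult.commute)
      moreover have "v\<^sup>2 \<noteq> 0" using u by (simp add: v_def)
      ultimately show "transcendental_over \<iota> x1"
        using transcendental_over_poly[OF A.emb B.transc, of "[:0, v\<^sup>2:]"] by simp
      have "y1\<^sup>2 = \<iota> v ^ 6 * (x' ^ 3 + \<iota> u ^ 4 * \<iota> a * x' + \<iota> u ^ 6 * \<iota> b)"
        using B.curve_eq unfolding u(2,3) by (simp add: y1_def power_mult_distrib)
      also have "\<dots> = x1 ^ 3 + \<iota> a * x1 + \<iota> b" unfolding x1_def using uv by algebra
      finally show "y1\<^sup>2 = x1 ^ 3 + \<iota> a * x1 + \<iota> b" .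
    qed (use A.emb A.nonsing in auto)
    moreover have "adjoin \<iota> {x1, y1} = adjoin \<iota> {x', y'}"
    proof (rule adjoin_eqI)
      show "{x1, y1} \<subseteq> adjoin \<iota> {x', y'}"
        unfolding B.E_def[symmetric] x1_def y1_def by (auto intro!: B.E.mems B.E_gens)
      interpret C: weierstrass_curve \<iota> x1 y1 a b by fact
      have "x' = \<iota> u ^ 2 * x1" "y' = \<iota> u ^ 3 * y1" unfolding x1_def y1_def using uv by algebra+
      then show "{x', y'} \<subseteq> adjoin \<iota> {x1, y1}"
        unfolding C.E_def[symmetric] by (auto intro!: C.E.mems C.E_gens)
    qed
    ultimately show "isomorphic_over \<iota> (adjoin \<iota> {x, y}) (adjoin \<iota> {x', y'})"
      using isomorphic_over_of_same_equation[OF assms(1)] by metis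
  }
qed

section \<open>The j-invariant\<close>

lemma j_ratio_eq_iff:
  fixes a b a' b' :: "'k::field_char_0"
  assumes "4 * a ^ 3 + 27 * b\<^sup>2 \<noteq> 0" "4 * a' ^ 3 + 27 * b'\<^sup>2 \<noteq> 0"
  shows "1728 * (4 * a ^ 3) / (4 * a ^ 3 + 27 * b\<^sup>2) = 1728 * (4 * a' ^ 3) / (4 * a' ^ 3 + 27 * b'\<^sup>2)
    \<longleftrightarrow> a ^ 3 * b'\<^sup>2 = a' ^ 3 * b\<^sup>2"
proof -
  have "1728 * (4 * a ^ 3) / (4 * a ^ 3 + 27 * b\<^sup>2) = 1728 * (4 * a' ^ 3) / (4 * a' ^ 3 + 27 * b'\<^sup>2)
    \<longleftrightarrow> 1728 * (4 * a ^ 3) * (4 * a' ^ 3 + 27 * b'\<^sup>2) = 1728 * (4 * a' ^ 3) * (4 * a ^ 3 + 27 * b\<^sup>2)"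
    using assms by (rule frac_eq_eq)
  \<comment> \<open>The products of both cubes cancel; 186624 = 1728 * 4 * 27.\<close>
  also have "\<dots> \<longleftrightarrow> 186624 * (a ^ 3 * b'\<^sup>2) = 186624 * (a' ^ 3 * b\<^sup>2)"
    by (simp add: algebra_simps)
  finally show ?thesis by simp
qed

lemma weierstrass_model_iff:
  fixes \<iota> :: "'k::{alg_closed_field, field_char_0} \<Rightarrow> 'f::field"
  assumes "field_embedding \<iota>"
  shows "weierstrass_model \<iota> F a b \<longleftrightarrow> (\<exists>x y. weierstrass_curve \<iota> x y a b \<and> F = adjoin \<iota> {x, y})"
  using assms by (auto simp: weierstrass_model_def weierstrass_curve_def)

text \<open>The description in \<open>j_invariant\<close> has a unique value because
  \<open>ratio_eq_of_same_field\<close> gives all models of one field the same ratio.\<close>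

lemma j_invariant_weierstrass:
  assumes "weierstrass_curve \<iota> x y a b"
  shows "j_invariant \<iota> (adjoin \<iota> {x, y}) = 1728 * (4 * a ^ 3) / (4 * a ^ 3 + 27 * b\<^sup>2)"
  unfolding j_invariant_def
proof (rule the_equality)
  interpret weierstrass_curve \<iota> x y a b by fact
  show "\<exists>a' b'. weierstrass_model \<iota> (adjoin \<iota> {x, y}) a' b' \<and>
      1728 * (4 * a ^ 3) / (4 * a ^ 3 + 27 * b\<^sup>2) = 1728 * (4 * a' ^ 3) / (4 * a' ^ 3 + 27 * b'\<^sup>2)"
    using assms weierstrass_model_iff[OF emb] by blast
  fix j assume "\<exists>a' b'. weierstrass_model \<iota> (adjoin \<iota> {x, y}) a' b' \<and>
      j = 1728 * (4 * a' ^ 3) / (4 * a' ^ 3 + 27 * b'\<^sup>2)"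
  then obtain a' b' x' y' where 1: "weierstrass_curve \<iota> x' y' a' b'"
      "adjoin \<iota> {x, y} = adjoin \<iota> {x', y'}" "j = 1728 * (4 * a' ^ 3) / (4 * a' ^ 3 + 27 * b'\<^sup>2)"
    unfolding weierstrass_model_iff[OF emb] by blast
  interpret B: weierstrass_curve \<iota> x' y' a' b' by fact
  show "j = 1728 * (4 * a ^ 3) / (4 * a ^ 3 + 27 * b\<^sup>2)"
    unfolding 1(3) j_ratio_eq_iff[OF B.nonsing nonsing]
    using ratio_eq_of_same_field[OF assms 1(1,2)] by simp
qed

section \<open>The two elliptic subfields\<close>

text \<open>Translation by a third of \<open>s\<close> removes the quadratic term; 4 a^3 + 27 b^2 is
  then minus the discriminant of the original cubic.\<close>

lemma weierstrass_of_cubic: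
  fixes \<iota> :: "'k::{alg_closed_field, field_char_0} \<Rightarrow> 'f::field"
  assumes emb: "field_embedding \<iota>" and t: "transcendental_over \<iota> t"
    and eq: "y\<^sup>2 = t ^ 3 - \<iota> s * t\<^sup>2 + \<iota> r * t - 1"
    and D: "27 - 18 * s * r - s\<^sup>2 * r\<^sup>2 + 4 * s ^ 3 + 4 * r ^ 3 \<noteq> 0"
    and ab: "s = 3 * m" "a = r - 3 * m\<^sup>2" "b = m * r - 2 * m ^ 3 - 1"
  shows "weierstrass_curve \<iota> (t - \<iota> m) y a b"
    and "adjoin \<iota> {t - \<iota> m, y} = adjoin \<iota> {t, y}"
proof -
  interpret unital_ring_hom \<iota> by (rule field_embedding_hom[OF emb])
  show curve: "weierstrass_curve \<iota> (t - \<iota> m) y a b"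
  proof
    have "poly (map_poly \<iota> [:- m, 1:]) t = t - \<iota> m" by (simp add: map_poly_pCons_hom)
    with transcendental_over_poly[OF emb t, of "[:- m, 1:]"]
    show "transcendental_over \<iota> (t - \<iota> m)" by simp
    have "\<iota> s = 3 * \<iota> m" "\<iota> a = \<iota> r - 3 * \<iota> m ^ 2" "\<iota> b = \<iota> m * \<iota> r - 2 * \<iota> m ^ 3 - 1"
      unfolding ab by simp_all
    with eq show "y\<^sup>2 = (t - \<iota> m) ^ 3 + \<iota> a * (t - \<iota> m) + \<iota> b" by algebra
    have "4 * a ^ 3 + 27 * b\<^sup>2 = 27 - 18 * s * r - s\<^sup>2 * r\<^sup>2 + 4 * s ^ 3 + 4 * r ^ 3"
      unfolding ab by algebra
    with D show "4 * a ^ 3 + 27 * b\<^sup>2 \<noteq> 0" by simp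
  qed (rule emb)
  interpret A: weierstrass_curve \<iota> "t - \<iota> m" y a b by fact
  interpret T: subfield "adjoin \<iota> {t, y}" by standard (rule adjoin_subfield)
  have T: "t \<in> adjoin \<iota> {t, y}" "y \<in> adjoin \<iota> {t, y}" "\<iota> m \<in> adjoin \<iota> {t, y}"
    using adjoin_subfield(2,3)[where \<iota> = \<iota> and S = "{t, y}"] by auto
  show "adjoin \<iota> {t - \<iota> m, y} = adjoin \<iota> {t, y}"
  proof (rule adjoin_eqI)
    show "{t - \<iota> m, y} \<subseteq> adjoin \<iota> {t, y}" using T by (auto intro: T.mems)
    have "t = (t - \<iota> m) + \<iota> m" by simp
    then show "{t, y} \<subseteq> adjoin \<iota> {t - \<iota> m, y}"
      unfolding A.E_def[symmetric] using A.E_gens A.E.add_mem by (metis empty_subsetI insert_subset)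
  qed
qed

theorem mainTheorem3:
  fixes \<iota> :: "'k::{alg_closed_field, field_char_0} \<Rightarrow> 'f::field"
    and s1 s2 u v :: 'k
    and X Y :: 'f
    and K E1 E2 :: "'f set"
  assumes "field_embedding \<iota>"
    and "27 - 18 * s1 * s2 - s1 ^ 2 * s2 ^ 2 + 4 * s1 ^ 3 + 4 * s2 ^ 3 \<noteq> 0"
    and "transcendental_over \<iota> X"
    and "Y ^ 2 = X ^ 6 - \<iota> s1 * X ^ 4 + \<iota> s2 * X ^ 2 - 1"
    and "K = adjoin \<iota> {X, Y}"
    and "u = s1 * s2"
    and "v = s1 ^ 3 + s2 ^ 3"
    and "E1 = adjoin \<iota> {X ^ 2, Y}"
    and "E2 = adjoin \<iota> {X ^ 2, X * Y}"
  shows "(isomorphic_over \<iota> E1 E2 \<longleftrightarrow> j_invariant \<iota> E1 = j_invariant \<iota> E2) \<and>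
         (isomorphic_over \<iota> E1 E2 \<longleftrightarrow> (v ^ 2 - 4 * u ^ 3) * (v - 9 * u + 27) = 0)"
proof -
  note emb = assms(1)
  interpret unital_ring_hom \<iota> by (rule field_embedding_hom[OF emb])
  define m1 m2 where "m1 = s1 / 3" and "m2 = s2 / 3"
  have m: "s1 = 3 * m1" "s2 = 3 * m2" by (simp_all add: m1_def m2_def)
  define a1 b1 where "a1 = s2 - 3 * m1\<^sup>2" and "b1 = m1 * s2 - 2 * m1 ^ 3 - 1"
  define a2 b2 where "a2 = s1 - 3 * m2\<^sup>2" and "b2 = m2 * s1 - 2 * m2 ^ 3 - 1"
  have "poly (map_poly \<iota> [:0, 0, 1:]) X = X\<^sup>2" by (simp add: map_poly_pCons_hom power2_eq_square)
  with transcendental_over_poly[OF emb assms(3), of "[:0, 0, 1:]"]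
  have t: "transcendental_over \<iota> (X\<^sup>2)" by simp
  have eq1: "Y\<^sup>2 = (X\<^sup>2) ^ 3 - \<iota> s1 * (X\<^sup>2)\<^sup>2 + \<iota> s2 * X\<^sup>2 - 1"
    using assms(4) by (simp flip: power_mult)
  note W1 = weierstrass_of_cubic[OF emb t eq1 assms(2) m(1) a1_def b1_def]
  have X: "X \<noteq> 0"
    using assms(3)[unfolded transcendental_over_def, rule_format, of "[:0, 1:]"]
    by (simp add: map_poly_pCons_hom)
  obtain i :: 'k where "i ^ 2 = - 1" using nth_root_exists[of 2 "- 1 :: 'k"] by auto
  then have i: "\<iota> i ^ 2 = - 1" by (metis one power uminus)
  \<comment> \<open>Dividing (X Y)^2 = t^4 - s1 t^3 + s2 t^2 - t by t^4 gives a cubic in 1/t with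
    leading coefficient -1; the factor \<open>i\<close> makes it monic and exchanges s1 with
    s2.\<close>
  define t2 y2 where "t2 = inverse (X\<^sup>2)" and "y2 = \<iota> i * (X * Y) * t2\<^sup>2"
  have t2: "transcendental_over \<iota> t2"
    unfolding t2_def by (rule transcendental_over_inverse[OF emb t])
  have X2: "X\<^sup>2 * t2 = 1" using X by (simp add: t2_def)
  have eq2: "y2\<^sup>2 = t2 ^ 3 - \<iota> s2 * t2\<^sup>2 + \<iota> s1 * t2 - 1"
    unfolding y2_def using i X2 eq1 by algebra
  have D2: "27 - 18 * s2 * s1 - s2\<^sup>2 * s1\<^sup>2 + 4 * s2 ^ 3 + 4 * s1 ^ 3 \<noteq> 0"
    using assms(2) by (simp add: algebra_simps)
  note W2 = weierstrass_of_cubic[OF emb t2 eq2 D2 m(2) a2_def b2_def]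
  have "adjoin \<iota> {t2, y2} = E2"
    unfolding assms(9)
  proof (rule adjoin_eqI)
    interpret S: subfield "adjoin \<iota> {X\<^sup>2, X * Y}" by standard (rule adjoin_subfield)
    have "X\<^sup>2 \<in> adjoin \<iota> {X\<^sup>2, X * Y}" "X * Y \<in> adjoin \<iota> {X\<^sup>2, X * Y}"
      "\<iota> i \<in> adjoin \<iota> {X\<^sup>2, X * Y}"
      using adjoin_subfield(2,3)[where \<iota> = \<iota> and S = "{X\<^sup>2, X * Y}"] by auto
    then show "{t2, y2} \<subseteq> adjoin \<iota> {X\<^sup>2, X * Y}"
      by (auto simp: t2_def y2_def intro!: S.mult_mem S.inverse_mem S.power_mem[of "inverse _"])
    interpret T: subfield "adjoin \<iota> {t2, y2}" by standard (rule adjoin_subfield)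
    have T: "t2 \<in> adjoin \<iota> {t2, y2}" "y2 \<in> adjoin \<iota> {t2, y2}" "\<iota> i \<in> adjoin \<iota> {t2, y2}"
      using adjoin_subfield(2,3)[where \<iota> = \<iota> and S = "{t2, y2}"] by auto
    have "X\<^sup>2 = inverse t2" by (simp add: t2_def)
    moreover have "X * Y = - \<iota> i * y2 * (inverse t2)\<^sup>2"
      unfolding y2_def calculation[symmetric] using i X2 by algebra
    ultimately show "{X\<^sup>2, X * Y} \<subseteq> adjoin \<iota> {t2, y2}"
      using T by (auto intro!: T.mult_mem T.inverse_mem T.power_mem T.uminus_mem)
  qed
  with W2(2) have E2: "E2 = adjoin \<iota> {t2 - \<iota> m2, y2}" by simp
  have E1: "E1 = adjoin \<iota> {X\<^sup>2 - \<iota> m1, Y}" using W1(2) assms(8) by simp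
  have iso: "isomorphic_over \<iota> E1 E2 \<longleftrightarrow> a1 ^ 3 * b2\<^sup>2 = a2 ^ 3 * b1\<^sup>2"
    unfolding E1 E2 by (rule isomorphic_over_iff_ratio_eq[OF W1(1) W2(1)])
  have "j_invariant \<iota> E1 = j_invariant \<iota> E2 \<longleftrightarrow> a1 ^ 3 * b2\<^sup>2 = a2 ^ 3 * b1\<^sup>2"
    unfolding E1 E2 j_invariant_weierstrass[OF W1(1)] j_invariant_weierstrass[OF W2(1)]
    by (rule j_ratio_eq_iff[OF weierstrass_curve.nonsing[OF W1(1)] weierstrass_curve.nonsing[OF W2(1)]])
  moreover have "a1 ^ 3 * b2\<^sup>2 = a2 ^ 3 * b1\<^sup>2 \<longleftrightarrow> (v ^ 2 - 4 * u ^ 3) * (v - 9 * u + 27) = 0"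
  proof -
    let ?D = "27 - 18 * s1 * s2 - s1 ^ 2 * s2 ^ 2 + 4 * s1 ^ 3 + 4 * s2 ^ 3"
    \<comment> \<open>Since 4 a^3 + 27 b^2 equals \<open>?D\<close> for both curves, 27 times the
      difference is \<open>?D\<close> times a2^3 - a1^3. Another factor 27 clears the denominators
      of the cubes, and (s1^2 - 3 s2)^3 - (s2^2 - 3 s1)^3 factors as shown.\<close>
    have "729 * (a2 ^ 3 * b1\<^sup>2 - a1 ^ 3 * b2\<^sup>2) = ?D * ((s1 ^ 3 - s2 ^ 3) * (v - 9 * u + 27))"
      unfolding a1_def b1_def a2_def b2_def assms(6,7) m by algebra
    moreover have "v ^ 2 - 4 * u ^ 3 = (s1 ^ 3 - s2 ^ 3)\<^sup>2"
      unfolding assms(6,7) by algebra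
    ultimately show ?thesis using assms(2)
      by (metis (no_types, lifting) eq_iff_diff_eq_0 mult_eq_0_iff power_eq_0_iff zero_neq_numeral pos2)
  qed
  ultimately show ?thesis using iso by blast
qed

end
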